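(* Let $s\ge2$ and $t\ge1$ be coprime integers. Then \[ \sum_{\lambda\in\mathcal C_s\cap\mathcal C_t}\frac1{|\operatorname{Stab}_{s,t}(\lambda)|}=\frac{t^{s-1}}{s!}, \] where $\operatorname{Stab}_{s,t}(\lambda)$ is the stabiliser of $\lambda$ under the level $t$ action of $\tilde{\mathfrak S}_s$ on $\mathcal C_s$.
   Context: Let $\mathbb N=\{1,2,\dots\}$ and $s\circ t=\frac12(s-1)(t-1)$ (an integer, since $s,t$ are coprime). A partition is a weakly decreasing sequence $\lambda=(\lambda_1,\lambda_2,\dots)$ of non-negative integers, eventually $0$; its conjugate is $\lambda'$ with $\lambda'_i=|\{j\ge1:\lambda_j\ge i\}|$. For $(r,c)\in\mathbb N^2$ with $c\le\lambda_r$, the $(r,c)$-hook length of $\lambda$ is $1+(\lambda_r-r)+(\lambda'_c-c)$. $\lambda$ is an $s$-core if none of its hook lengths equals $s$; $\mathcal C_s$ is the set of all $s$-cores (and $\mathcal C_t$ that of all $t$-cores). The set $\mathcal C_s\cap\mathcal C_t$ is finite. The beta-set of $\lambda$ is $\mathcal B^\lambda=\{\lambda_i-i: i\in\mathbb N\}$. Affine symmetric group: $\tilde{\mathfrak S}_s$ is the group of permutations $w$ of $\mathbb Z$ with $w(m+s)=w(m)+s$ for all $m$ and $w(0)+\dots+w(s-1)=\binom s2$. Elements of $\mathbb Z/s\mathbb Z$ are regarded as congruence classes, i.e. subsets of $\mathbb Z$; for $i\in\mathbb Z/s\mathbb Z$ and integers $a,b$, $ia+b$ denotes the class of $xa+b$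 for $x\in i$. For $i\in\mathbb Z/s\mathbb Z$, $w_i\in\tilde{\mathfrak S}_s$ is given by $w_i(m)=m+1$ if $m\in i-1$, $w_i(m)=m-1$ if $m\in i$, and $w_i(m)=m$ otherwise; the $w_i$ generate $\tilde{\mathfrak S}_s$. Level $t$ action: the level $t$ action $w\mapsto\mathring w$ of $\tilde{\mathfrak S}_s$ on $\mathbb Z$ is the action determined on generators by $\mathring w_i(m)=m+t$ if $m\in(i-1)t-s\circ t$, $\mathring w_i(m)=m-t$ if $m\in it-s\circ t$, and $\mathring w_i(m)=m$ otherwise. The level $t$ action $w\mapsto\check w$ on $\mathcal C_s$ is defined by letting $\check w\lambda$ be the unique partition with $\mathcal B^{\check w\lambda}=\mathring w(\mathcal B^\lambda)$ (this is again an $s$-core). *)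

theory Defs
  imports Complex_Main "HOL-Number_Theory.Cong" "HOL-Algebra.Group_Action"
begin

text \<open>A partition is a sequence indexed by \<open>1, 2, \<dots>\<close>; the value at the unused index \<open>0\<close> is
  normalised to \<open>0\<close>, so that equality of functions is equality of partitions.\<close>

definition is_partition :: "(nat \<Rightarrow> nat) \<Rightarrow> bool" where
  "is_partition lam \<longleftrightarrow>
     lam 0 = 0 \<and> (\<forall>i\<ge>1. lam (Suc i) \<le> lam i) \<and> (\<exists>n. \<forall>i\<ge>n. lam i = 0)"

definition conjugate :: "(nat \<Rightarrow> nat) \<Rightarrow> nat \<Rightarrow> nat" where
  "conjugate lam i = card {j. 1 \<le> j \<and> i \<le> lam j}"

definition hook_length :: "(nat \<Rightarrow> nat) \<Rightarrow> nat \<Rightarrow> nat \<Rightarrow> int" where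
  "hook_length lam r c = 1 + (int (lam r) - int r) + (int (conjugate lam c) - int c)"

definition cores :: "nat \<Rightarrow> (nat \<Rightarrow> nat) set" where
  "cores s = {lam. is_partition lam \<and>
     (\<forall>r c. 1 \<le> r \<and> 1 \<le> c \<and> c \<le> lam r \<longrightarrow> hook_length lam r c \<noteq> int s)}"

definition beta_set :: "(nat \<Rightarrow> nat) \<Rightarrow> int set" where
  "beta_set lam = {int (lam i) - int i | i. 1 \<le> i}"

definition affine_sym :: "nat \<Rightarrow> (int \<Rightarrow> int) monoid" where
  "affine_sym s =
     \<lparr>carrier = {w. bij w \<and> (\<forall>m. w (m + int s) = w m + int s) \<and>
                    (\<Sum>m\<in>{0..<int s}. w m) = int (s choose 2)},
      monoid.mult = (\<circ>),
      one = id\<rparr>"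

text \<open>Elements of \<open>\<int>/s\<int>\<close> are given by integer representatives \<open>i\<close>, and membership of \<open>m\<close> in the
  class of \<open>x\<close> is \<open>[m = x] (mod s)\<close>.\<close>

definition affine_gen :: "nat \<Rightarrow> int \<Rightarrow> int \<Rightarrow> int" where
  "affine_gen s i m =
     (if [m = i - 1] (mod int s) then m + 1
      else if [m = i] (mod int s) then m - 1
      else m)"

text \<open>\<open>s \<circ> t = (s - 1)(t - 1)/2\<close>; the division is exact for coprime \<open>s\<close> and \<open>t\<close>.\<close>

definition circ :: "nat \<Rightarrow> nat \<Rightarrow> int" where
  "circ s t = (int s - 1) * (int t - 1) div 2"

definition level_gen :: "nat \<Rightarrow> nat \<Rightarrow> int \<Rightarrow> int \<Rightarrow> int" where
  "level_gen s t i m =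
     (if [m = (i - 1) * int t - circ s t] (mod int s) then m + int t
      else if [m = i * int t - circ s t] (mod int s) then m - int t
      else m)"

text \<open>The action of the affine symmetric group on \<open>\<int>\<close> determined by its values on the
  generators. Extensionality fixes the junk values outside the group, so that the action is unique
  as a HOL function.\<close>

definition level_action :: "nat \<Rightarrow> nat \<Rightarrow> (int \<Rightarrow> int) \<Rightarrow> int \<Rightarrow> int" where
  "level_action s t =
     (THE \<phi>. group_action (affine_sym s) (UNIV :: int set) \<phi> \<and>
             \<phi> \<in> extensional (carrier (affine_sym s)) \<and>
             (\<forall>i. \<phi> (affine_gen s i) = level_gen s t i))"

definition core_action ::
    "nat \<Rightarrow> nat \<Rightarrow> (int \<Rightarrow> int) \<Rightarrow> (nat \<Rightarrow> nat) \<Rightarrow> (nat \<Rightarrow> nat)" where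
  "core_action s t w =
     (\<lambda>lam \<in> cores s. THE mu. is_partition mu \<and>
        beta_set mu = level_action s t w ` beta_set lam)"

definition Stab :: "nat \<Rightarrow> nat \<Rightarrow> (nat \<Rightarrow> nat) \<Rightarrow> (int \<Rightarrow> int) set" where
  "Stab s t lam = stabilizer (affine_sym s) (core_action s t) lam"

end

theory Submission
  imports Defs "HOL-Combinatorics.Permutations"
begin

text \<open>Write \<open>c = s \<circ> t\<close>. As \<open>s\<close> and \<open>t\<close> are coprime, every integer has the form
\<open>point j k = j t - c + s k\<close>, and the pair \<open>(j, k)\<close> is unique up to \<open>(j + s, k - t)\<close>. In these
coordinates cores, the level action and stabilisers all take a simple form, and the sum becomes a
count of lists of residues.

A partition is an \<open>s\<close>-core iff its beta-set is closed under subtracting \<open>s\<close>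
(\<open>cores_iff_beta_set\<close>). For fixed \<open>j\<close> the \<open>k\<close> with \<open>point j k\<close> in such a beta-set therefore form a
ray \<open>k < x j\<close>, and the \<open>s\<close>-core is encoded by a function \<open>x\<close> on the integers with
\<open>x (j + s) = x j - t\<close>. The constant \<open>c\<close> is exactly the one for which the sets
\<open>{point j k | k < x j}\<close> that are beta-sets of partitions are those with
\<open>x 0 + \<dots> + x (s - 1) = 0\<close> (\<open>beads_charge\<close>). Such an \<open>x\<close> is called a label here.

The level \<open>t\<close> action sends \<open>point j k\<close> to \<open>point (w j) k\<close>. This formula is an action with the right
values on the generators, and it is the only one because the generators generate the group
(\<open>affine_sym_induct\<close>). On labels it is \<open>x \<mapsto> x \<circ> w\<inverse>\<close>, so the stabiliser of the core with label \<open>x\<close>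
consists of the \<open>w\<close> with \<open>x \<circ> w = x\<close> (\<open>Stab_core_of\<close>). Subtracting \<open>t\<close> from \<open>point j k\<close> lowers \<open>j\<close>
by one, so the core is also a \<open>t\<close>-core iff \<open>x\<close> is weakly decreasing (\<open>bij_betw_core_of\<close>); such a
label is called dominant.

Now reduce \<open>x 0, \<dots>, x (s - 1)\<close> modulo \<open>t\<close>. The resulting list of residues has sum \<open>0\<close> modulo
\<open>t\<close>. A dominant label is determined by the multiset of its residues, and every multiset of \<open>s\<close>
residues with sum \<open>0\<close> occurs (\<open>bij_betw_dominant_labels_multisets\<close>). Reducing \<open>w\<close> modulo \<open>s\<close>
identifies the stabiliser of \<open>x\<close> with the group of permutations of positions that fix the residue
list (\<open>bij_betw_residue_perm\<close>). By orbit counting, \<open>s! / |Stab|\<close> is the number of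
rearrangements of the residue list. Summing over all dominant labels counts each list of \<open>s\<close>
residues modulo \<open>t\<close> with sum \<open>0\<close> once, and there are \<open>t ^ (s - 1)\<close> of these, since the first entry
is determined by the others.\<close>

section \<open>Quasi-periodic functions\<close>

text \<open>Three kinds of functions on the integers are treated together: elements of the affine
symmetric group have \<open>d = p = s\<close>, labels of \<open>s\<close>-cores have \<open>p = s\<close> and \<open>d = - t\<close>, and periodic
functions have \<open>d = 0\<close>.\<close>

definition quasi_periodic :: "int \<Rightarrow> int \<Rightarrow> (int \<Rightarrow> int) \<Rightarrow> bool" where
  "quasi_periodic p d f \<longleftrightarrow> (\<forall>m. f (m + p) = f m + d)"

lemma quasi_periodic_mult:
  assumes "quasi_periodic p d f"
  shows "f (m + k * p) = f m + k * d"
proof (induction k rule: int_induct[where k = 0])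
  case (step1 i)
  have "f (m + i * p + p) = f (m + i * p) + d"
    using assms by (simp add: quasi_periodic_def)
  then show ?case using step1 by (simp add: algebra_simps)
next
  case (step2 i)
  have "f (m + (i - 1) * p + p) = f (m + (i - 1) * p) + d"
    using assms by (simp add: quasi_periodic_def)
  then show ?case using step2 by (simp add: algebra_simps)
qed simp

lemma quasi_periodic_mod:
  assumes "quasi_periodic p d f"
  shows "f m = f (m mod p) + m div p * d"
  using quasi_periodic_mult[OF assms, of "m mod p" "m div p"] by simp

lemma quasi_periodic_eqI:
  assumes "p > 0" "quasi_periodic p d f" "quasi_periodic p d g"
    and "\<And>j. 0 \<le> j \<Longrightarrow> j < p \<Longrightarrow> f j = g j"
  shows "f = g"
proof
  fix m
  show "f m = g m"
    using quasi_periodic_mod[OF assms(2), of m] quasi_periodic_mod[OF assms(3), of m]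
      assms(1,4) by simp
qed

text \<open>Injectivity of \<open>w\<close> on the whole line gives injectivity modulo \<open>p\<close>, because a translate of \<open>w j\<close> by a
multiple of \<open>p\<close> is again a value of \<open>w\<close>.\<close>

lemma bij_betw_residues:
  assumes "p > 0" "quasi_periodic p p w" "inj w"
  shows "bij_betw (\<lambda>j. w j mod p) {0..<p} {0..<p}"
proof -
  have "inj_on (\<lambda>j. w j mod p) {0..<p}"
  proof (rule inj_onI)
    fix i j assume ij: "i \<in> {0..<p}" "j \<in> {0..<p}" and eq: "w i mod p = w j mod p"
    have "w i = w j + (w i div p - w j div p) * p"
      using eq unfolding minus_div_mult_eq_mod[symmetric] by (simp add: algebra_simps)
    also have "\<dots> = w (j + (w i div p - w j div p) * p)"
      using quasi_periodic_mult[OF assms(2)] by simp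
    finally have "i = j + (w i div p - w j div p) * p"
      using assms(3) by (simp add: inj_eq)
    then have "i mod p = j mod p" by (metis mod_mult_self1)
    then show "i = j" using ij by simp
  qed
  moreover have "(\<lambda>j. w j mod p) ` {0..<p} \<subseteq> {0..<p}"
    using assms(1) by auto
  ultimately show ?thesis
    by (simp add: bij_betw_def endo_inj_surj)
qed

lemma bij_if_inj_quasi_periodic:
  assumes "p > 0" "quasi_periodic p p w" "inj w"
  shows "bij w"
proof -
  have "\<exists>j. w j = m" for m
  proof -
    have "m mod p \<in> (\<lambda>j. w j mod p) ` {0..<p}"
      using bij_betw_residues[OF assms] assms(1) by (simp add: bij_betw_def)
    then obtain i where i: "m mod p = w i mod p" by auto
    have "w (i + (m div p - w i div p) * p) = w i + (m div p - w i div p) * p"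
      using quasi_periodic_mult[OF assms(2)] by simp
    also have "\<dots> = m"
      using i unfolding minus_div_mult_eq_mod[symmetric] by (simp add: algebra_simps)
    finally show ?thesis by blast
  qed
  then have "surj w" by (metis surjI)
  with assms(3) show ?thesis by (simp add: bij_def)
qed

text \<open>A periodic function is a function of residues, and \<open>w\<close> only permutes the residues. The multiset
version is the common source of the sum rules below and of the invariance of residue multisets
under shifts.\<close>

lemma image_mset_periodic_compose:
  assumes "p > 0" "quasi_periodic p p w" "inj w" "\<And>m. g (m + p) = g m"
  shows "image_mset (\<lambda>j. g (w j)) (mset_set {0..<p}) = image_mset g (mset_set {0..<p})"
proof -
  have per: "g (m + k * p) = g m" for m k
  proof (induction k rule: int_induct[where k = 0])
    case (step1 i)
    have "g (m + (i + 1) * p) = g (m + i * p)"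
      using assms(4)[of "m + i * p"] by (simp add: algebra_simps)
    then show ?case using step1 by simp
  next
    case (step2 i)
    have "g (m + (i - 1) * p) = g (m + i * p)"
      using assms(4)[of "m + (i - 1) * p"] by (simp add: algebra_simps)
    then show ?case using step2 by simp
  qed simp
  have "g (w j) = g (w j mod p)" for j
    using per[of "w j mod p" "w j div p"] by simp
  then have "image_mset (\<lambda>j. g (w j)) (mset_set {0..<p})
      = image_mset g (image_mset (\<lambda>j. w j mod p) (mset_set {0..<p}))"
    by (simp add: multiset.map_comp comp_def)
  also have "image_mset (\<lambda>j. w j mod p) (mset_set {0..<p}) = mset_set {0..<p}"
    using bij_betw_residues[OF assms(1-3)]
    by (simp add: bij_betw_def image_mset_mset_set)
  finally show ?thesis .
qed

lemma sum_periodic_compose: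
  fixes g :: "int \<Rightarrow> int"
  assumes "p > 0" "quasi_periodic p p w" "inj w" "\<And>m. g (m + p) = g m"
  shows "(\<Sum>j\<in>{0..<p}. g (w j)) = (\<Sum>j\<in>{0..<p}. g j)"
  using image_mset_periodic_compose[of p w g, OF assms] by (simp add: sum_unfold_sum_mset)

lemma sum_periodic_shift:
  fixes g :: "int \<Rightarrow> int"
  assumes "p > 0" "\<And>m. g (m + p) = g m"
  shows "(\<Sum>j\<in>{a..<a + p}. g j) = (\<Sum>j\<in>{0..<p}. g j)"
proof -
  have "(\<Sum>j\<in>{a..<a + p}. g j) = (\<Sum>j\<in>{0..<p}. g (j + a))"
    by (rule sum.reindex_bij_witness[of _ "\<lambda>j. j + a" "\<lambda>j. j - a"]) auto
  also have "\<dots> = (\<Sum>j\<in>{0..<p}. g j)"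
    by (rule sum_periodic_compose) (use assms in \<open>auto simp: quasi_periodic_def inj_def\<close>)
  finally show ?thesis .
qed

text \<open>The combination \<open>p f m - d m\<close> is periodic, so its sum over a period is not changed by \<open>w\<close>.\<close>

lemma sum_quasi_periodic_compose:
  assumes "p > 0" "quasi_periodic p p w" "inj w" "quasi_periodic p d f"
  shows "p * (\<Sum>j\<in>{0..<p}. f (w j)) - p * (\<Sum>j\<in>{0..<p}. f j)
    = d * (\<Sum>j\<in>{0..<p}. w j - j)"
proof -
  have "(\<Sum>j\<in>{0..<p}. p * f (w j) - d * w j) = (\<Sum>j\<in>{0..<p}. p * f j - d * j)"
    using assms(4) by (intro sum_periodic_compose[OF assms(1-3), of "\<lambda>m. p * f m - d * m"])
      (simp add: quasi_periodic_def algebra_simps)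
  then show ?thesis by (simp add: sum_subtractf sum_distrib_left right_diff_distrib)
qed

section \<open>The affine symmetric group and its generators\<close>

lemma sum_int_lessThan: "(\<Sum>m\<in>{0..<int s}. m) = int (s choose 2)"
proof (induction s)
  case (Suc s)
  have "{0..<int (Suc s)} = insert (int s) {0..<int s}" by auto
  with Suc show ?case by (simp add: numeral_2_eq_2)
qed simp

text \<open>Since \<open>0 + \<dots> + (s - 1)\<close> equals \<open>s\<close> choose \<open>2\<close>, the normalisation says that the periodic
function \<open>w m - m\<close> has sum zero over a period; this form is stable under composition and inversion
by the sum rules for periodic functions.\<close>

lemma affine_sym_iff:
  "w \<in> carrier (affine_sym s) \<longleftrightarrow>
    bij w \<and> quasi_periodic (int s) (int s) w \<and> (\<Sum>m\<in>{0..<int s}. w m - m) = 0"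
  unfolding affine_sym_def quasi_periodic_def
  by (simp add: sum_subtractf sum_int_lessThan)

lemma mult_affine_sym [simp]: "v \<otimes>\<^bsub>affine_sym s\<^esub> w = v \<circ> w"
  and one_affine_sym [simp]: "\<one>\<^bsub>affine_sym s\<^esub> = id"
  by (simp_all add: affine_sym_def)

lemma comp_mem_affine_sym:
  assumes "s > 0" "v \<in> carrier (affine_sym s)" "w \<in> carrier (affine_sym s)"
  shows "v \<circ> w \<in> carrier (affine_sym s)"
proof -
  have v: "bij v" "quasi_periodic s s v" "(\<Sum>m\<in>{0..<int s}. v m - m) = 0"
    and w: "bij w" "quasi_periodic s s w" "(\<Sum>m\<in>{0..<int s}. w m - m) = 0"
    using assms by (auto simp: affine_sym_iff)
  have "(\<Sum>m\<in>{0..<int s}. v (w m) - w m) = (\<Sum>m\<in>{0..<int s}. v m - m)"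
    using v w assms(1)
    by (intro sum_periodic_compose[of _ w "\<lambda>m. v m - m"]) (auto simp: quasi_periodic_def bij_def)
  then have "(\<Sum>m\<in>{0..<int s}. v (w m) - m) = 0"
    using v(3) w(3) by (simp add: sum_subtractf)
  then show ?thesis
    using v w by (auto simp: affine_sym_iff bij_comp quasi_periodic_def)
qed

lemma inv_mem_affine_sym:
  assumes "s > 0" "w \<in> carrier (affine_sym s)"
  shows "inv_into UNIV w \<in> carrier (affine_sym s)"
proof -
  have w: "bij w" "quasi_periodic s s w" "(\<Sum>m\<in>{0..<int s}. w m - m) = 0"
    using assms by (auto simp: affine_sym_iff)
  have inv: "w (inv_into UNIV w m) = m" "inv_into UNIV w (w m) = m" for m
    using w(1) by (simp_all add: bij_def surj_f_inv_f)
  have qp: "quasi_periodic s s (inv_into UNIV w)"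
    using w(1,2) inv unfolding quasi_periodic_def by (metis)
  have "(\<Sum>m\<in>{0..<int s}. inv_into UNIV w (w m) - w m) = (\<Sum>m\<in>{0..<int s}. inv_into UNIV w m - m)"
    using w qp assms(1)
    by (intro sum_periodic_compose[of _ w "\<lambda>m. inv_into UNIV w m - m"]) (auto simp: quasi_periodic_def bij_def)
  then have "(\<Sum>m\<in>{0..<int s}. inv_into UNIV w m - m) = 0"
    using w(3) inv by (simp add: sum_subtractf)
  then show ?thesis
    using w qp by (auto simp: affine_sym_iff bij_imp_bij_inv)
qed

lemma group_affine_sym:
  assumes "s > 0"
  shows "group (affine_sym s)"
proof (rule groupI)
  show "\<one>\<^bsub>affine_sym s\<^esub> \<in> carrier (affine_sym s)"
    by (simp add: affine_sym_iff quasi_periodic_def)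
  fix w assume w: "w \<in> carrier (affine_sym s)"
  then show "\<exists>v\<in>carrier (affine_sym s). v \<otimes>\<^bsub>affine_sym s\<^esub> w = \<one>\<^bsub>affine_sym s\<^esub>"
    using inv_mem_affine_sym[OF assms w] by (auto simp: affine_sym_iff bij_def intro!: bexI[of _ "inv_into UNIV w"])
qed (simp_all add: comp_mem_affine_sym[OF assms] o_assoc)

lemma affine_gen_involution:
  assumes "s \<ge> 2"
  shows "affine_gen s i (affine_gen s i m) = m"
proof -
  have "\<not> [i = i - 1] (mod int s)" "\<not> [i - 1 = i] (mod int s)"
    using assms zdvd_imp_le[of "int s" 1] by (auto simp: cong_iff_dvd_diff)
  moreover have "[m = i - 1] (mod int s) \<longleftrightarrow> [m + 1 = i] (mod int s)"
    "[m = i] (mod int s) \<longleftrightarrow> [m - 1 = i - 1] (mod int s)"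
    by (simp_all add: cong_iff_dvd_diff algebra_simps)
  ultimately show ?thesis
    unfolding affine_gen_def by (auto; metis cong_trans cong_sym)
qed

lemma affine_gen_plus: "affine_gen s i (m + int s) = affine_gen s i m + int s"
  by (simp add: affine_gen_def cong_def)

lemma affine_gen_at:
  assumes "s \<ge> 2"
  shows "affine_gen s i (i - 1) = i" "affine_gen s i i = i - 1"
    "j \<in> {i + 1..<i + int s - 1} \<Longrightarrow> affine_gen s i j = j"
proof -
  have "\<not> [i = i - 1] (mod int s)"
    using assms zdvd_imp_le[of "int s" 1] by (auto simp: cong_iff_dvd_diff)
  then show "affine_gen s i (i - 1) = i" "affine_gen s i i = i - 1"
    by (simp_all add: affine_gen_def)
  assume j: "j \<in> {i + 1..<i + int s - 1}"
  then have "\<not> [j = i] (mod int s)" "\<not> [j = i - 1] (mod int s)"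
    using zdvd_imp_le[of "int s" "j - i"] zdvd_imp_le[of "int s" "j - (i - 1)"]
    by (auto simp: cong_iff_dvd_diff)
  then show "affine_gen s i j = j" by (simp add: affine_gen_def)
qed

text \<open>A generator moves just two integers of the period \<open>i - 1, \<dots>, i + s - 2\<close>, which makes this period
the convenient one for comparing sums before and after composing with it.\<close>

lemma sum_period_at_gen:
  fixes g :: "int \<Rightarrow> int"
  assumes "s \<ge> 2" "\<And>m. g (m + int s) = g m"
  shows "(\<Sum>j\<in>{0..<int s}. g j) = g (i - 1) + g i + (\<Sum>j\<in>{i + 1..<i + int s - 1}. g j)"
proof -
  have "{i - 1..<i - 1 + int s} = insert (i - 1) (insert i {i + 1..<i + int s - 1})"
    using assms(1) by auto
  then show ?thesis
    using sum_periodic_shift[of "int s" g "i - 1"] assms by simp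
qed

lemma affine_gen_mem:
  assumes "s \<ge> 2"
  shows "affine_gen s i \<in> carrier (affine_sym s)"
proof -
  have "bij (affine_gen s i)"
    by (rule involuntory_imp_bij) (simp add: affine_gen_involution[OF assms])
  moreover have "(\<Sum>m\<in>{0..<int s}. affine_gen s i m - m) = 0"
    using sum_period_at_gen[OF assms, of "\<lambda>m. affine_gen s i m - m" i]
    by (simp add: affine_gen_plus affine_gen_at[OF assms])
  ultimately show ?thesis
    by (simp add: affine_sym_iff quasi_periodic_def affine_gen_plus)
qed

text \<open>An increasing injective \<open>w\<close> increases by at least \<open>1\<close> in each step, so the periodic function
\<open>w m - m\<close> is monotone, hence constant, and its sum over a period is zero.\<close>

lemma affine_sym_increasing_imp_id:
  assumes "s > 0" "w \<in> carrier (affine_sym s)" "\<And>i. w (i - 1) \<le> w i"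
  shows "w = id"
proof -
  have w: "bij w" "quasi_periodic s s w" "(\<Sum>m\<in>{0..<int s}. w m - m) = 0"
    using assms by (auto simp: affine_sym_iff)
  have less: "w (i - 1) < w i" for i
    using assms(3)[of i] inj_eq[of w "i - 1" i] w(1) by (simp add: bij_def order_less_le)
  have mono: "w m - m \<le> w (m + int n) - (m + int n)" for m n
  proof (induction n)
    case (Suc n)
    then show ?case using less[of "m + int (Suc n)"] by simp
  qed simp
  have const: "w m - m = w 0" if "m \<in> {0..<int s}" for m
  proof (rule antisym)
    have "w m - m \<le> w (m + int (s - nat m)) - (m + int (s - nat m))" by (rule mono)
    also have "m + int (s - nat m) = 0 + int s" using that by auto
    also have "w (0 + int s) - (0 + int s) = w 0"
      using quasi_periodic_mult[OF w(2), of 0 1] by simp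
    finally show "w m - m \<le> w 0" .
    show "w 0 \<le> w m - m" using mono[of 0 "nat m"] that by simp
  qed
  then have "(\<Sum>m\<in>{0..<int s}. w m - m) = (\<Sum>m\<in>{0..<int s}. w 0)"
    by (rule sum.cong[OF refl])
  then have "w 0 = 0" using w(3) assms(1) by simp
  have "w m = id m" if "0 \<le> m" "m < int s" for m
    using const[of m] that \<open>w 0 = 0\<close> by simp
  then show ?thesis
    using w(2) assms(1) by (intro quasi_periodic_eqI[of "int s" "int s" w id])
      (auto simp: quasi_periodic_def)
qed

text \<open>A termination measure for sorting \<open>w\<close> by generators. It replaces the number of inversions
(the Coxeter length) and spares the finiteness argument that the latter would need.\<close>

definition displacement :: "nat \<Rightarrow> (int \<Rightarrow> int) \<Rightarrow> int" where
  "displacement s w = (\<Sum>m\<in>{0..<int s}. (w m - m)\<^sup>2)"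

text \<open>Exchanging the values \<open>a > b\<close> at the adjacent places \<open>i - 1\<close> and \<open>i\<close> changes the sum of squares by
\<open>2 (b - a)\<close>: only the mixed terms differ.\<close>

lemma displacement_decreases:
  assumes "s \<ge> 2" "quasi_periodic s s w" "w (i - 1) > w i"
  shows "displacement s (w \<circ> affine_gen s i) < displacement s w"
proof -
  have per: "(w (m + int s) - (m + int s))\<^sup>2 = (w m - m)\<^sup>2" for m
    using assms(2) by (simp add: quasi_periodic_def)
  have per': "(w (affine_gen s i (m + int s)) - (m + int s))\<^sup>2 = (w (affine_gen s i m) - m)\<^sup>2" for m
    using assms(2) by (simp add: quasi_periodic_def affine_gen_plus)
  have rest: "(\<Sum>j\<in>{i + 1..<i + int s - 1}. (w (affine_gen s i j) - j)\<^sup>2)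
      = (\<Sum>j\<in>{i + 1..<i + int s - 1}. (w j - j)\<^sup>2)"
    by (rule sum.cong) (simp_all add: affine_gen_at[OF assms(1)])
  have "displacement s (w \<circ> affine_gen s i) - displacement s w
      = (w i - (i - 1))\<^sup>2 + (w (i - 1) - i)\<^sup>2 - (w (i - 1) - (i - 1))\<^sup>2 - (w i - i)\<^sup>2"
    unfolding displacement_def comp_def
      sum_period_at_gen[where g = "\<lambda>m. (w m - m)\<^sup>2", OF assms(1) per, of i]
      sum_period_at_gen[where g = "\<lambda>m. (w (affine_gen s i m) - m)\<^sup>2", OF assms(1) per', of i]
    by (simp add: rest affine_gen_at[OF assms(1)])
  also have "\<dots> = 2 * (w i - w (i - 1))"
    by (simp add: power2_eq_square algebra_simps)
  finally show ?thesis using assms(3) by simp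
qed

text \<open>The generators generate the affine symmetric group: an element without descents is the identity,
and composing with the generator at a descent lowers the displacement.\<close>

lemma affine_sym_induct [consumes 2, case_names id gen]:
  assumes "s \<ge> 2" "w \<in> carrier (affine_sym s)"
    and id: "P id"
    and gen: "\<And>v i. v \<in> carrier (affine_sym s) \<Longrightarrow> P v \<Longrightarrow> P (v \<circ> affine_gen s i)"
  shows "P w"
  using assms(2)
proof (induction "nat (displacement s w)" arbitrary: w rule: less_induct)
  case less
  show ?case
  proof (cases "\<exists>i. w (i - 1) > w i")
    case False
    then have "w = id" using affine_sym_increasing_imp_id[OF _ less.prems] assms(1)
      by (simp add: not_less)
    then show ?thesis using id by simp
  next
    case True
    then obtain i where i: "w (i - 1) > w i" by blast
    let ?v = "w \<circ> affine_gen s i"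
    have v: "?v \<in> carrier (affine_sym s)"
      using assms(1) less.prems by (simp add: comp_mem_affine_sym affine_gen_mem)
    have "displacement s ?v < displacement s w"
      using less.prems i assms(1) by (intro displacement_decreases) (auto simp: affine_sym_iff)
    moreover have "displacement s ?v \<ge> 0"
      by (simp add: displacement_def sum_nonneg)
    ultimately have "P ?v" using less.hyps v by simp
    moreover have "?v \<circ> affine_gen s i = w"
      by (simp add: fun_eq_iff affine_gen_involution[OF assms(1)])
    ultimately show ?thesis using gen[OF v] by metis
  qed
qed

section \<open>The level action in coordinates\<close>

definition point :: "nat \<Rightarrow> nat \<Rightarrow> int \<Rightarrow> int \<Rightarrow> int" where
  "point s t j k = j * int t - circ s t + int s * k"

lemma point_cong_iff:
  assumes "coprime s t"
  shows "[point s t j k = i * int t - circ s t] (mod int s) \<longleftrightarrow> [j = i] (mod int s)"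
proof -
  have "point s t j k - (i * int t - circ s t) = (j - i) * int t + int s * k"
    by (simp add: point_def algebra_simps)
  then have "[point s t j k = i * int t - circ s t] (mod int s) \<longleftrightarrow> int s dvd (j - i) * int t"
    by (simp add: cong_iff_dvd_diff dvd_add_left_iff)
  also have "\<dots> \<longleftrightarrow> int s dvd j - i"
    using assms by (intro coprime_dvd_mult_left_iff) simp
  finally show ?thesis by (simp add: cong_iff_dvd_diff)
qed

text \<open>The two coordinates are determined up to trading \<open>s\<close> steps of size \<open>t\<close> for \<open>t\<close> steps of size \<open>s\<close>.\<close>

lemma point_eq_iff:
  assumes "coprime s t" "s > 0"
  shows "point s t j k = point s t j' k' \<longleftrightarrow> (\<exists>n. j' = j + n * int s \<and> k' = k - n * int t)"
proof
  assume eq: "point s t j k = point s t j' k'"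
  have "[point s t j' k' = j * int t - circ s t] (mod int s)"
    using eq point_cong_iff[OF assms(1), of j k j] by simp
  then have "int s dvd j' - j"
    using point_cong_iff[OF assms(1)] by (simp add: cong_iff_dvd_diff)
  then obtain n where n: "j' - j = int s * n" ..
  have "int s * k = (j' - j) * int t + int s * k'"
    using eq by (simp add: point_def algebra_simps)
  also have "\<dots> = int s * (k' + n * int t)"
    unfolding n by (simp add: algebra_simps)
  finally have "k = k' + n * int t" using assms(2) by simp
  then show "\<exists>n. j' = j + n * int s \<and> k' = k - n * int t"
    using n by (intro exI[of _ n]) (simp add: algebra_simps)
qed (auto simp: point_def algebra_simps)

lemma point_exhaust:
  assumes "coprime s t"
  obtains j k where "m = point s t j k"
proof -
  from assms have "coprime (int t) (int s)" by (simp add: coprime_commute)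
  then obtain u where "[int t * u = 1] (mod int s)" using cong_solve_coprime_int by blast
  then have "int s dvd 1 - int t * u" by (simp add: cong_iff_dvd_diff dvd_diff_commute)
  then obtain v where v: "1 - int t * u = int s * v" ..
  have "m = point s t ((m + circ s t) * u) ((m + circ s t) * v)"
  proof -
    have "point s t ((m + circ s t) * u) ((m + circ s t) * v)
      = (m + circ s t) * (int t * u + int s * v) - circ s t"
      by (simp add: point_def algebra_simps)
    also have "int t * u + int s * v = 1" using v by simp
    finally show ?thesis by simp
  qed
  then show thesis by (rule that)
qed

text \<open>The level action in closed form. A description by coordinates avoids choosing a representative \<open>j\<close>
of the class of \<open>m\<close>, at the price of having to show that the choice does not matter.\<close>

definition level_map :: "nat \<Rightarrow> nat \<Rightarrow> (int \<Rightarrow> int) \<Rightarrow> int \<Rightarrow> int" where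
  "level_map s t w m = (THE n. \<exists>j k. m = point s t j k \<and> n = point s t (w j) k)"

text \<open>The description is independent of the coordinates because \<open>w\<close> commutes with \<open>j \<mapsto> j + s\<close>.\<close>

lemma level_map_point:
  assumes "coprime s t" "s > 0" "quasi_periodic s s w"
  shows "level_map s t w (point s t j k) = point s t (w j) k"
  unfolding level_map_def
proof (rule the_equality)
  fix n assume "\<exists>j' k'. point s t j k = point s t j' k' \<and> n = point s t (w j') k'"
  then obtain j' k' where eq: "point s t j k = point s t j' k'" and n: "n = point s t (w j') k'"
    by blast
  from eq obtain a where a: "j' = j + a * int s" "k' = k - a * int t"
    using point_eq_iff[OF assms(1,2)] by blast
  then show "n = point s t (w j) k"
    unfolding n using quasi_periodic_mult[OF assms(3), of j a]
    by (simp add: point_eq_iff[OF assms(1,2)])  (rule exI[of _ "-a"], simp)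
qed blast

lemma level_map_gen:
  assumes "coprime s t" "s > 0"
  shows "level_map s t (affine_gen s i) = level_gen s t i"
proof
  fix m
  obtain j k where m: "m = point s t j k" using point_exhaust[OF assms(1)] .
  have "level_map s t (affine_gen s i) m = point s t (affine_gen s i j) k"
    unfolding m using assms by (intro level_map_point) (auto simp: quasi_periodic_def affine_gen_plus)
  also have "\<dots> = level_gen s t i m"
    unfolding level_gen_def affine_gen_def m point_cong_iff[OF assms(1)]
    by (simp add: point_def algebra_simps)
  finally show "level_map s t (affine_gen s i) m = level_gen s t i m" .
qed

lemma level_map_comp:
  assumes "coprime s t" "s > 0" "quasi_periodic s s v" "quasi_periodic s s w"
  shows "level_map s t (v \<circ> w) = level_map s t v \<circ> level_map s t w"
proof
  fix m
  obtain j k where m: "m = point s t j k" using point_exhaust[OF assms(1)] .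
  have "quasi_periodic s s (v \<circ> w)" using assms(3,4) by (simp add: quasi_periodic_def)
  then show "level_map s t (v \<circ> w) m = (level_map s t v \<circ> level_map s t w) m"
    unfolding m using assms by (simp add: level_map_point)
qed

lemma level_map_id:
  assumes "coprime s t" "s > 0"
  shows "level_map s t id = id"
proof
  fix m
  obtain j k where m: "m = point s t j k" using point_exhaust[OF assms(1)] .
  show "level_map s t id m = id m"
    unfolding m using assms by (simp add: level_map_point quasi_periodic_def)
qed

lemma bij_level_map:
  assumes "coprime s t" "s > 0" "w \<in> carrier (affine_sym s)"
  shows "bij (level_map s t w)"
proof (rule o_bij)
  have w: "bij w" "quasi_periodic s s w" "quasi_periodic s s (inv_into UNIV w)"
    using assms inv_mem_affine_sym[OF assms(2,3)] by (auto simp: affine_sym_iff)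
  then have "inv_into UNIV w \<circ> w = id" "w \<circ> inv_into UNIV w = id"
    by (auto simp: bij_def fun_eq_iff surj_f_inv_f)
  then show "level_map s t (inv_into UNIV w) \<circ> level_map s t w = id"
    "level_map s t w \<circ> level_map s t (inv_into UNIV w) = id"
    using level_map_comp[OF assms(1,2)] w level_map_id[OF assms(1,2)] by metis+
qed

lemma mult_BijGroup_UNIV:
  assumes "bij f" "bij g"
  shows "f \<otimes>\<^bsub>BijGroup UNIV\<^esub> g = f \<circ> g"
  using assms by (simp add: BijGroup_def Bij_def extensional_def compose_def fun_eq_iff)

lemma group_action_level_map:
  assumes "coprime s t" "s > 0"
  shows "group_action (affine_sym s) UNIV (restrict (level_map s t) (carrier (affine_sym s)))"
proof (intro group_action.intro group_hom.intro group_hom_axioms.intro)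
  show "group (affine_sym s)" by (rule group_affine_sym[OF assms(2)])
next
  show "group (BijGroup (UNIV :: int set))" by (rule group_BijGroup)
next
  show "restrict (level_map s t) (carrier (affine_sym s)) \<in> hom (affine_sym s) (BijGroup UNIV)"
  proof (rule homI)
    fix w assume "w \<in> carrier (affine_sym s)"
    then show "restrict (level_map s t) (carrier (affine_sym s)) w \<in> carrier (BijGroup UNIV)"
      using bij_level_map[OF assms] by (simp add: BijGroup_def Bij_def extensional_def)
  next
    fix v w assume vw: "v \<in> carrier (affine_sym s)" "w \<in> carrier (affine_sym s)"
    then have "quasi_periodic s s v" "quasi_periodic s s w" by (simp_all add: affine_sym_iff)
    then show "restrict (level_map s t) (carrier (affine_sym s)) (v \<otimes>\<^bsub>affine_sym s\<^esub> w)
      = restrict (level_map s t) (carrier (affine_sym s)) v \<otimes>\<^bsub>BijGroup UNIV\<^esub>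
        restrict (level_map s t) (carrier (affine_sym s)) w"
      using vw bij_level_map[OF assms] comp_mem_affine_sym[OF assms(2)]
      by (simp add: mult_BijGroup_UNIV level_map_comp[OF assms])
  qed
qed

text \<open>Both actions are homomorphisms, so the set where they agree is closed under composing with a
generator.\<close>

lemma affine_sym_action_unique:
  assumes "s \<ge> 2" "group_action (affine_sym s) (UNIV :: int set) \<phi>"
    "group_action (affine_sym s) (UNIV :: int set) \<psi>"
    and gens: "\<And>i. \<phi> (affine_gen s i) = \<psi> (affine_gen s i)"
    and "w \<in> carrier (affine_sym s)"
  shows "\<phi> w = \<psi> w"
  using assms(1,5)
proof (induction rule: affine_sym_induct)
  case id
  show ?case
    by (metis group_action.id_eq_one[OF assms(2)] group_action.id_eq_one[OF assms(3)] one_affine_sym)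
next
  case (gen v i)
  have "\<chi> (v \<circ> affine_gen s i) = \<chi> v \<otimes>\<^bsub>BijGroup UNIV\<^esub> \<chi> (affine_gen s i)"
    if "group_action (affine_sym s) (UNIV :: int set) \<chi>" for \<chi>
    using group_hom.hom_mult[OF group_action.group_hom[OF that] gen(1) affine_gen_mem[OF assms(1)]]
    by simp
  from this[OF assms(2)] this[OF assms(3)] show ?case using gen(2) gens by metis
qed

lemma level_action_eq_level_map:
  assumes "coprime s t" "s \<ge> 2" "w \<in> carrier (affine_sym s)"
  shows "level_action s t w = level_map s t w"
proof -
  let ?L = "restrict (level_map s t) (carrier (affine_sym s))"
  have s: "s > 0" using assms(2) by simp
  have L: "group_action (affine_sym s) UNIV ?L" by (rule group_action_level_map[OF assms(1) s])
  have gens: "?L (affine_gen s i) = level_gen s t i" for i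
    using affine_gen_mem[OF assms(2)] level_map_gen[OF assms(1) s] by simp
  have "level_action s t = ?L"
    unfolding level_action_def
  proof (rule the_equality)
    fix \<phi> :: "(int \<Rightarrow> int) \<Rightarrow> int \<Rightarrow> int"
    assume \<phi>: "group_action (affine_sym s) UNIV \<phi> \<and> \<phi> \<in> extensional (carrier (affine_sym s)) \<and>
      (\<forall>i. \<phi> (affine_gen s i) = level_gen s t i)"
    have "\<phi> w = ?L w" if "w \<in> carrier (affine_sym s)" for w
    proof (rule affine_sym_action_unique[OF assms(2) _ L _ that])
      show "group_action (affine_sym s) UNIV \<phi>" using \<phi> by blast
      show "\<phi> (affine_gen s i) = ?L (affine_gen s i)" for i using \<phi> gens by metis
    qed
    then show "\<phi> = ?L"
      using \<phi> by (intro extensionalityI[of \<phi> "carrier (affine_sym s)"]) (blast, rule restrict_extensional, blast)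
  next
    show "group_action (affine_sym s) UNIV ?L \<and> ?L \<in> extensional (carrier (affine_sym s)) \<and>
      (\<forall>i. ?L (affine_gen s i) = level_gen s t i)"
      using L gens restrict_extensional by blast
  qed
  then show ?thesis using assms(3) by simp
qed

section \<open>Beta-sets\<close>

lemma partition_antimono:
  assumes "is_partition lam" "1 \<le> i" "i \<le> j"
  shows "lam j \<le> lam i"
  using assms(3)
proof (induction j rule: dec_induct)
  case (step j)
  then show ?case using assms(1,2) unfolding is_partition_def by (meson le_trans)
qed simp

lemma beta_less_iff:
  assumes "is_partition lam" "1 \<le> i" "1 \<le> j"
  shows "int (lam j) - int j < int (lam i) - int i \<longleftrightarrow> i < j"
  using partition_antimono[OF assms(1,2), of j] partition_antimono[OF assms(1,3), of i]
  by (cases "i < j") auto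

lemma beta_set_image: "beta_set lam = (\<lambda>i. int (lam i) - int i) ` {1..}"
  by (auto simp: beta_set_def)

lemma inj_on_beta:
  assumes "is_partition lam"
  shows "inj_on (\<lambda>i. int (lam i) - int i) {1..}"
  by (rule inj_onI) (metis assms atLeast_iff beta_less_iff linorder_neqE_nat less_irrefl)

text \<open>The position of a part can be read off the beta-set as the number of larger elements. This is what
makes a partition recoverable from its beta-set.\<close>

lemma card_beta_above:
  assumes "is_partition lam" "1 \<le> i"
  shows "card {b \<in> beta_set lam. b > int (lam i) - int i} = i - 1"
proof -
  have "{b \<in> beta_set lam. b > int (lam i) - int i} = (\<lambda>j. int (lam j) - int j) ` {1..<i}"
    using beta_less_iff[OF assms(1) _ assms(2)] by (fastforce simp: beta_set_def)
  moreover have "inj_on (\<lambda>j. int (lam j) - int j) {1..<i}"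
    using inj_on_beta[OF assms(1)] by (rule inj_on_subset) auto
  ultimately show ?thesis by (simp add: card_image)
qed

lemma beta_set_inject:
  assumes "is_partition lam" "is_partition mu" "beta_set lam = beta_set mu"
  shows "lam = mu"
proof
  fix i
  show "lam i = mu i"
  proof (cases "i = 0")
    case True
    then show ?thesis using assms by (simp add: is_partition_def)
  next
    case False
    then have "int (lam i) - int i \<in> beta_set mu"
      unfolding assms(3)[symmetric] by (auto simp: beta_set_def)
    then obtain j where j: "1 \<le> j" "int (lam i) - int i = int (mu j) - int j"
      by (auto simp: beta_set_def)
    have "i - 1 = card {b \<in> beta_set mu. b > int (mu j) - int j}"
      using card_beta_above[OF assms(1), of i] False j(2) assms(3) by simp
    also have "\<dots> = j - 1" using card_beta_above[OF assms(2) j(1)] .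
    finally have "i = j" using False j(1) by simp
    then show ?thesis using j(2) by simp
  qed
qed

text \<open>This characterises the beta-sets of partitions. The threshold \<open>N\<close> has to be low enough that all
integers below \<open>- N\<close> are in \<open>B\<close>; then the cardinality condition expresses that \<open>B\<close> has as many
nonnegative elements as it misses negative integers, which does not depend on the choice of such an \<open>N\<close>.\<close>

definition charge_zero :: "int set \<Rightarrow> nat \<Rightarrow> bool" where
  "charge_zero B N \<longleftrightarrow> {..< - int N} \<subseteq> B \<and> finite (B \<inter> {- int N..}) \<and> card (B \<inter> {- int N..}) = N"

lemma charge_zero_beta_set:
  assumes "is_partition lam"
  obtains N0 where "\<And>N. N \<ge> N0 \<Longrightarrow> charge_zero (beta_set lam) N"
proof -
  obtain N0 where N0: "\<forall>i\<ge>N0. lam i = 0" using assms by (auto simp: is_partition_def)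
  have "charge_zero (beta_set lam) N" if "N \<ge> N0" for N
  proof -
    have zero: "lam i = 0" if "i > N" for i using N0 that \<open>N \<ge> N0\<close> by simp
    have "{..< - int N} \<subseteq> beta_set lam"
    proof
      fix m assume "m \<in> {..< - int N}"
      then have "nat (- m) > N" "m = int (lam (nat (- m))) - int (nat (- m))"
        using zero[of "nat (- m)"] by auto
      then show "m \<in> beta_set lam"
        unfolding beta_set_def by (intro CollectI exI[of _ "nat (- m)"]) auto
    qed
    moreover have eq: "beta_set lam \<inter> {- int N..} = (\<lambda>i. int (lam i) - int i) ` {1..N}"
    proof -
      have "i \<le> N" if "- int N \<le> int (lam i) - int i" for i
        using zero[of i] that by (cases "i > N") auto
      then show ?thesis by (fastforce simp: beta_set_def)
    qed
    moreover have "inj_on (\<lambda>i. int (lam i) - int i) {1..N}"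
      using inj_on_beta[OF assms] by (rule inj_on_subset) auto
    ultimately show ?thesis by (simp add: charge_zero_def card_image)
  qed
  then show thesis by (rule that)
qed

text \<open>List the \<open>N\<close> elements of \<open>B\<close> that are at least \<open>- N\<close> in decreasing order and add \<open>i\<close> to the
\<open>i\<close>-th of them. Since there are exactly \<open>N\<close> of them, the \<open>i\<close>-th one is at least \<open>- i\<close>, so the parts
are nonnegative, and the remaining parts \<open>0\<close> produce all integers below \<open>- N\<close>.\<close>

lemma beta_set_surj:
  assumes "charge_zero B N"
  obtains lam where "is_partition lam" "beta_set lam = B"
proof -
  define xs where "xs = rev (sorted_list_of_set (B \<inter> {- int N..}))"
  have fin: "finite (B \<inter> {- int N..})" and low: "{..< - int N} \<subseteq> B"
    using assms by (auto simp: charge_zero_def)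
  have len: "length xs = N" using assms by (simp add: xs_def charge_zero_def)
  have set: "set xs = B \<inter> {- int N..}" using fin by (simp add: xs_def)
  have dec: "xs ! j < xs ! i" if "i < j" "j < N" for i j
  proof -
    have "sorted_wrt (>) xs"
      unfolding xs_def sorted_wrt_rev using strict_sorted_list_of_set by simp
    then show ?thesis using that len by (simp add: sorted_wrt_iff_nth_less)
  qed
  have ge: "xs ! i \<ge> - int (Suc i)" if "i < N" for i
  proof -
    \<comment> \<open>Counted from the end of the list, where the entries start at \<open>- N\<close> or above.\<close>
    have "xs ! (N - 1 - k) \<ge> - int N + int k" if "k < N" for k
      using that
    proof (induction k)
      case 0
      then have "xs ! (N - 1) \<in> set xs" using len by simp
      then show ?case using set by simp
    next
      case (Suc k)
      have "xs ! (N - 1 - k) < xs ! (N - 1 - Suc k)" using Suc.prems by (intro dec) auto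
      then show ?case using Suc by simp
    qed
    from this[of "N - 1 - i"] show ?thesis using that by simp
  qed
  define lam where "lam i = (if 1 \<le> i \<and> i \<le> N then nat (xs ! (i - 1) + int i) else 0)" for i
  have lam: "int (lam i) - int i = xs ! (i - 1)" if "1 \<le> i" "i \<le> N" for i
  proof -
    have "xs ! (i - 1) \<ge> - int (Suc (i - 1))" using that by (intro ge) auto
    then show ?thesis using that by (simp add: lam_def)
  qed
  have "is_partition lam"
    unfolding is_partition_def
  proof (intro conjI allI impI)
    show "lam 0 = 0" by (simp add: lam_def)
    show "\<exists>n. \<forall>i\<ge>n. lam i = 0" by (intro exI[of _ "Suc N"]) (simp add: lam_def)
    fix i :: nat assume i: "1 \<le> i"
    show "lam (Suc i) \<le> lam i"
    proof (cases "Suc i \<le> N")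
      case True
      then show ?thesis using dec[of "i - 1" i] lam[of i] lam[of "Suc i"] i by simp
    qed (simp add: lam_def)
  qed
  moreover have "beta_set lam = B"
  proof -
    have "beta_set lam = (\<lambda>i. int (lam i) - int i) ` {1..N} \<union> (\<lambda>i. int (lam i) - int i) ` {N<..}"
      unfolding beta_set_image image_Un[symmetric] by (rule arg_cong[where f = "image _"]) auto
    also have "(\<lambda>i. int (lam i) - int i) ` {1..N} = (\<lambda>i. xs ! (i - 1)) ` {1..N}"
      by (intro image_cong) (simp_all add: lam)
    also have "\<dots> = (\<lambda>i. xs ! i) ` {..<N}"
      unfolding image_Suc_lessThan[symmetric] image_image by simp
    also have "\<dots> = B \<inter> {- int N..}"
      using set len by (auto simp: set_conv_nth)
    also have "(\<lambda>i. int (lam i) - int i) ` {N<..} = {..< - int N}"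
    proof (intro equalityI subsetI)
      fix m assume "m \<in> {..< - int N}"
      then show "m \<in> (\<lambda>i. int (lam i) - int i) ` {N<..}"
        by (intro image_eqI[of _ _ "nat (- m)"]) (auto simp: lam_def)
    qed (auto simp: lam_def)
    finally show ?thesis using low by auto
  qed
  ultimately show thesis by (rule that)
qed

lemma le_part_iff_le_conjugate:
  assumes "is_partition lam" "1 \<le> r" "1 \<le> c"
  shows "c \<le> lam r \<longleftrightarrow> r \<le> conjugate lam c"
proof -
  obtain n where n: "\<forall>i\<ge>n. lam i = 0" using assms(1) by (auto simp: is_partition_def)
  let ?J = "{j. 1 \<le> j \<and> c \<le> lam j}"
  have "?J \<subseteq> {..<n}" using n assms(3) by (auto simp: not_le[symmetric])
  then have fin: "finite ?J" by (rule finite_subset) simp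
  show ?thesis
  proof (cases "c \<le> lam r")
    case True
    then have "{1..r} \<subseteq> ?J" using partition_antimono[OF assms(1)] by (auto intro: le_trans)
    then have "card {1..r} \<le> conjugate lam c" unfolding conjugate_def by (rule card_mono[OF fin])
    then show ?thesis using True by simp
  next
    case False
    then have "?J \<subseteq> {1..<r}"
      using partition_antimono[OF assms(1,2)] by (fastforce simp: not_le intro: le_trans)
    then have "conjugate lam c \<le> card {1..<r}" unfolding conjugate_def by (intro card_mono) auto
    then show ?thesis using False assms(2) by simp
  qed
qed

text \<open>The complement of the beta-set is given by the columns of the Young diagram in the way the beta-set
is given by its rows. Reading the boundary of the diagram as a lattice path with steps numbered by
the integers, the beta-set collects the vertical steps and its complement the horizontal ones. For
the direction from left to right the column is found from the first row \<open>r\<close> with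
\<open>lam r - r < m\<close>.\<close>

lemma not_in_beta_set_iff:
  assumes "is_partition lam"
  shows "m \<notin> beta_set lam \<longleftrightarrow> (\<exists>c\<ge>1. m = int c - 1 - int (conjugate lam c))"
proof
  assume m: "m \<notin> beta_set lam"
  obtain n where n: "\<forall>i\<ge>n. lam i = 0" using assms by (auto simp: is_partition_def)
  define P where "P r \<longleftrightarrow> 1 \<le> r \<and> int (lam r) - int r < m" for r
  \<comment> \<open>For \<open>r > n\<close> the condition reads \<open>- r < m\<close>, so some row satisfies it.\<close>
  define r where "r = (LEAST r. P r)"
  have "P (max (n + 1) (nat (1 - m)))" using n by (auto simp: P_def)
  then have r: "P r" unfolding r_def by (rule LeastI)
  define c where "c = nat (m + int r)"
  have c: "int c = m + int r" "1 \<le> c" "lam r < c" using r by (auto simp: P_def c_def)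
  have "conjugate lam c < r"
    using le_part_iff_le_conjugate[OF assms, of r c] r c by (simp add: P_def)
  moreover have "r - 1 \<le> conjugate lam c"
  proof (cases "r = 1")
    case False
    have "r \<ge> 1" using r by (simp add: P_def)
    then have "r - 1 < (LEAST r. P r)" unfolding r_def[symmetric] by simp
    then have "\<not> P (r - 1)" by (rule not_less_Least)
    moreover have "int (lam (r - 1)) - int (r - 1) \<noteq> m"
    proof -
      have "int (lam (r - 1)) - int (r - 1) \<in> beta_set lam"
        unfolding beta_set_image using \<open>r \<ge> 1\<close> False by (intro imageI) simp
      then show ?thesis using m by blast
    qed
    ultimately have "c \<le> lam (r - 1)" using r False c(1) by (auto simp: P_def)
    then show ?thesis
      using le_part_iff_le_conjugate[OF assms, of "r - 1" c] r c False by (simp add: P_def)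
  qed simp
  ultimately have "m = int c - 1 - int (conjugate lam c)" using c by simp
  then show "\<exists>c\<ge>1. m = int c - 1 - int (conjugate lam c)" using c(2) by blast
next
  assume "\<exists>c\<ge>1. m = int c - 1 - int (conjugate lam c)"
  then obtain c where c: "1 \<le> c" "m = int c - 1 - int (conjugate lam c)" by blast
  show "m \<notin> beta_set lam"
  proof
    assume "m \<in> beta_set lam"
    then obtain r where "1 \<le> r" "m = int (lam r) - int r" by (auto simp: beta_set_def)
    then show False
      using le_part_iff_le_conjugate[OF assms, of r c] c by (cases "c \<le> lam r") auto
  qed
qed

text \<open>By the description of the complement, the hook length at \<open>(r, c)\<close> is the difference between the
element of the beta-set belonging to row \<open>r\<close> and the missing integer belonging to column \<open>c\<close>.
Positivity of such a difference puts the column inside the row.\<close>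

lemma cores_iff_beta_set:
  assumes "s > 0"
  shows "lam \<in> cores s \<longleftrightarrow> is_partition lam \<and> (\<forall>b\<in>beta_set lam. b - int s \<in> beta_set lam)"
proof (cases "is_partition lam")
  case True
  have "(\<exists>r c. 1 \<le> r \<and> 1 \<le> c \<and> c \<le> lam r \<and> hook_length lam r c = int s)
    \<longleftrightarrow> (\<exists>b\<in>beta_set lam. b - int s \<notin> beta_set lam)"
  proof
    assume "\<exists>r c. 1 \<le> r \<and> 1 \<le> c \<and> c \<le> lam r \<and> hook_length lam r c = int s"
    then obtain r c where rc: "1 \<le> r" "1 \<le> c" "c \<le> lam r" "hook_length lam r c = int s" by blast
    then have "int (lam r) - int r - int s = int c - 1 - int (conjugate lam c)"
      by (simp add: hook_length_def)
    then have "int (lam r) - int r - int s \<notin> beta_set lam"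
      using not_in_beta_set_iff[OF True] rc(2) by blast
    then show "\<exists>b\<in>beta_set lam. b - int s \<notin> beta_set lam"
      using rc(1) by (auto simp: beta_set_def)
  next
    assume "\<exists>b\<in>beta_set lam. b - int s \<notin> beta_set lam"
    then obtain r where r: "1 \<le> r" "int (lam r) - int r - int s \<notin> beta_set lam"
      by (auto simp: beta_set_def)
    then obtain c where c: "1 \<le> c" "int (lam r) - int r - int s = int c - 1 - int (conjugate lam c)"
      using not_in_beta_set_iff[OF True] by blast
    moreover have "c \<le> lam r"
      using le_part_iff_le_conjugate[OF True r(1) c(1)] c(2) assms by (cases "c \<le> lam r") auto
    ultimately show "\<exists>r c. 1 \<le> r \<and> 1 \<le> c \<and> c \<le> lam r \<and> hook_length lam r c = int s"
      using r(1) by (intro exI[of _ r] exI[of _ c]) (simp add: hook_length_def)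
  qed
  then show ?thesis using True by (auto simp: cores_def)
qed (simp add: cores_def)

section \<open>Cores as quasi-periodic functions\<close>

text \<open>The beta-set encoded by a label \<open>x\<close>, in the terminology of abacus displays: runner \<open>j\<close> is filled
up to position \<open>x j\<close>.\<close>

definition beads :: "nat \<Rightarrow> nat \<Rightarrow> (int \<Rightarrow> int) \<Rightarrow> int set" where
  "beads s t x = {point s t j k | j k. k < x j}"

definition core_labels :: "nat \<Rightarrow> nat \<Rightarrow> (int \<Rightarrow> int) set" where
  "core_labels s t = {x. quasi_periodic (int s) (- int t) x \<and> (\<Sum>j\<in>{0..<int s}. x j) = 0}"

text \<open>The labels of the simultaneous \<open>s\<close>- and \<open>t\<close>-cores. They form a fundamental domain for the
action of the affine symmetric group on labels.\<close>

definition dominant_labels :: "nat \<Rightarrow> nat \<Rightarrow> (int \<Rightarrow> int) set" where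
  "dominant_labels s t = {x \<in> core_labels s t. \<forall>j. x (j + 1) \<le> x j}"

lemma point_mem_beads:
  assumes "coprime s t" "s > 0" "quasi_periodic s (- int t) x"
  shows "point s t j k \<in> beads s t x \<longleftrightarrow> k < x j"
proof
  assume "point s t j k \<in> beads s t x"
  then obtain j' k' where eq: "point s t j k = point s t j' k'" and "k' < x j'"
    by (auto simp: beads_def)
  then obtain n where "j' = j + n * int s" "k' = k - n * int t"
    using point_eq_iff[OF assms(1,2)] by blast
  then show "k < x j"
    using \<open>k' < x j'\<close> quasi_periodic_mult[OF assms(3), of j n] by simp
qed (auto simp: beads_def)

lemma beads_inject:
  assumes "coprime s t" "s > 0" "quasi_periodic s (- int t) x" "quasi_periodic s (- int t) y"
    and "beads s t x = beads s t y"
  shows "x = y"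
proof
  fix j
  have "k < x j \<longleftrightarrow> k < y j" for k
    using point_mem_beads[OF assms(1-3), of j k] point_mem_beads[OF assms(1,2,4), of j k] assms(5)
    by simp
  from this[of "x j"] this[of "y j"] show "x j = y j" by auto
qed

lemma level_map_beads:
  assumes "coprime s t" "s > 0" "quasi_periodic s s w" "bij w"
  shows "level_map s t w ` beads s t x = beads s t (x \<circ> inv_into UNIV w)"
proof -
  have inv: "w (inv_into UNIV w m) = m" "inv_into UNIV w (w m) = m" for m
    using assms(4) by (simp_all add: bij_def surj_f_inv_f)
  have "level_map s t w ` beads s t x
      = {level_map s t w (point s t j k) | j k. k < x j}"
    unfolding beads_def by blast
  also have "\<dots> = {point s t (w j) k | j k. k < x j}"
    unfolding level_map_point[OF assms(1-3)] ..
  also have "\<dots> = beads s t (x \<circ> inv_into UNIV w)"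
    unfolding beads_def comp_def using inv by (auto; metis)
  finally show ?thesis .
qed

lemma beads_minus_s:
  assumes "m \<in> beads s t x"
  shows "m - int s \<in> beads s t x"
proof -
  obtain j k where "m = point s t j k" "k < x j" using assms by (auto simp: beads_def)
  then have "m - int s = point s t j (k - 1)" "k - 1 < x j"
    by (simp_all add: point_def algebra_simps)
  then show ?thesis by (auto simp: beads_def)
qed

text \<open>Subtracting \<open>t\<close> moves a bead to the same position on the preceding runner.\<close>

lemma beads_minus_t_iff:
  assumes "coprime s t" "s > 0" "quasi_periodic s (- int t) x"
  shows "(\<forall>m\<in>beads s t x. m - int t \<in> beads s t x) \<longleftrightarrow> (\<forall>j. x (j + 1) \<le> x j)"
proof -
  have step: "point s t (j + 1) k - int t = point s t j k" for j k
    by (simp add: point_def algebra_simps)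
  have "(\<forall>m\<in>beads s t x. m - int t \<in> beads s t x) \<longleftrightarrow>
    (\<forall>j k. k < x (j + 1) \<longrightarrow> point s t (j + 1) k - int t \<in> beads s t x)"
    unfolding beads_def by (auto; metis diff_add_cancel)
  also have "\<dots> \<longleftrightarrow> (\<forall>j k. k < x (j + 1) \<longrightarrow> k < x j)"
    unfolding step point_mem_beads[OF assms] ..
  also have "\<dots> \<longleftrightarrow> (\<forall>j. x (j + 1) \<le> x j)"
    by (meson less_le_trans not_le order_refl)
  finally show ?thesis .
qed

lemma two_sum_int_lessThan: "2 * (\<Sum>j\<in>{0..<int s}. j) = int s * (int s - 1)"
proof (induction s)
  case (Suc s)
  have "{0..<int (Suc s)} = insert (int s) {0..<int s}" by auto
  with Suc show ?case by (simp add: algebra_simps)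
qed simp

lemma two_circ:
  assumes "coprime s t"
  shows "2 * circ s t = (int s - 1) * (int t - 1)"
proof -
  have "\<not> (even s \<and> even t)" using coprime_common_divisor[OF assms, of 2] by auto
  then have "even ((int s - 1) * (int t - 1))" by auto
  then show ?thesis by (simp add: circ_def)
qed

text \<open>This identity pins down the constant \<open>s \<circ> t\<close>: the numbers \<open>j t - c\<close> for \<open>0 \<le> j < s\<close>
represent all residues modulo \<open>s\<close>, and for \<open>2 c = (s - 1) (t - 1)\<close> their sum equals
\<open>0 + \<dots> + (s - 1)\<close>, so that the quotients sum to zero.\<close>

lemma sum_point_div:
  assumes "coprime s t" "s > 0"
  shows "(\<Sum>j\<in>{0..<int s}. (j * int t - circ s t) div int s) = 0"
proof -
  let ?f = "\<lambda>j. (j * int t - circ s t) mod int s"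
  have inj: "inj_on ?f {0..<int s}"
  proof (rule inj_onI)
    fix i j assume ij: "i \<in> {0..<int s}" "j \<in> {0..<int s}" "?f i = ?f j"
    then have "[i = j] (mod int s)"
      using point_cong_iff[OF assms(1), of i 0 j] by (simp add: point_def cong_def)
    then show "i = j" using ij by (simp add: cong_def)
  qed
  have "?f ` {0..<int s} \<subseteq> {0..<int s}" using assms(2) by auto
  with inj have "bij_betw ?f {0..<int s} {0..<int s}"
    by (simp add: bij_betw_def endo_inj_surj)
  then have mod: "(\<Sum>j\<in>{0..<int s}. ?f j) = (\<Sum>j\<in>{0..<int s}. j)"
    using sum.reindex_bij_betw[of ?f _ _ "\<lambda>j. j"] by simp
  have "(\<Sum>j\<in>{0..<int s}. j * int t - circ s t)
      = int s * (\<Sum>j\<in>{0..<int s}. (j * int t - circ s t) div int s) + (\<Sum>j\<in>{0..<int s}. ?f j)"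
    by (simp add: sum_distrib_left flip: sum.distrib)
  then have "2 * (int s * (\<Sum>j\<in>{0..<int s}. (j * int t - circ s t) div int s))
      = int t * (2 * (\<Sum>j\<in>{0..<int s}. j)) - int s * (2 * circ s t) - 2 * (\<Sum>j\<in>{0..<int s}. j)"
    unfolding mod by (simp add: sum_subtractf algebra_simps flip: sum_distrib_right)
  also have "\<dots> = 0"
    unfolding two_sum_int_lessThan two_circ[OF assms(1)] by (simp add: algebra_simps)
  finally show ?thesis using assms(2) by simp
qed

text \<open>Counted runner by runner: above \<open>- s M\<close> runner \<open>j\<close> carries \<open>x j + M + q j\<close> beads, where
\<open>q j\<close> is the quotient of \<open>j t - c\<close> by \<open>s\<close>, and the quotients sum to zero. Thus the charge of the bead
set is the sum of \<open>x\<close> over a period.\<close>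

lemma beads_charge:
  assumes "coprime s t" "s > 0" "quasi_periodic s (- int t) x"
  obtains M0 :: nat where "\<And>M. M \<ge> M0 \<Longrightarrow> {..< - int (s * M)} \<subseteq> beads s t x"
    "\<And>M. M \<ge> M0 \<Longrightarrow> finite (beads s t x \<inter> {- int (s * M)..})"
    "\<And>M. M \<ge> M0 \<Longrightarrow> int (card (beads s t x \<inter> {- int (s * M)..})) = int (s * M) + (\<Sum>j\<in>{0..<int s}. x j)"
proof -
  define q where "q j = (j * int t - circ s t) div int s" for j
  define M0 where "M0 = nat (\<Sum>j\<in>{0..<int s}. \<bar>x j + q j\<bar>)"
  have ge_iff: "point s t j k \<ge> - int (s * M) \<longleftrightarrow> - int M - q j \<le> k" for j k M
  proof -
    have "point s t j k \<ge> - int (s * M) \<longleftrightarrow> 0 \<le> point s t j (k + int M)"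
      by (simp add: point_def algebra_simps)
    also have "\<dots> \<longleftrightarrow> 0 \<le> point s t j (k + int M) div int s"
      using assms(2) by (simp add: pos_imp_zdiv_nonneg_iff)
    also have "point s t j (k + int M) div int s = q j + (k + int M)"
      using assms(2) by (simp add: point_def q_def)
    finally show ?thesis by auto
  qed
  have bound: "- int M - q j \<le> x j" if "M \<ge> M0" "j \<in> {0..<int s}" for M j
  proof -
    have "\<bar>x j + q j\<bar> \<le> (\<Sum>j\<in>{0..<int s}. \<bar>x j + q j\<bar>)"
      using that(2) by (intro member_le_sum) auto
    then show ?thesis using that(1) unfolding M0_def by linarith
  qed
  have rep: "\<exists>j k. m = point s t j k \<and> j \<in> {0..<int s}" for m
  proof -
    obtain j k where m: "m = point s t j k" using point_exhaust[OF assms(1)] .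
    have "m = point s t (j mod int s) (k + (j div int s) * int t)"
      unfolding m point_eq_iff[OF assms(1,2)]
      by (rule exI[of _ "- (j div int s)"]) (simp add: minus_div_mult_eq_mod)
    then show ?thesis using assms(2) by (intro exI conjI) auto
  qed
  have low: "{..< - int (s * M)} \<subseteq> beads s t x" if "M \<ge> M0" for M
  proof
    fix m assume m: "m \<in> {..< - int (s * M)}"
    obtain j k where jk: "m = point s t j k" "j \<in> {0..<int s}" using rep by blast
    then have "k < - int M - q j" using m ge_iff[of M j k] by (simp add: not_le[symmetric])
    then show "m \<in> beads s t x" using bound[OF that jk(2)] jk(1) unfolding beads_def
      by (intro CollectI exI[of _ j] exI[of _ k]) simp
  qed
  let ?I = "\<lambda>M j. {- int M - q j..<x j}"
  have eq: "beads s t x \<inter> {- int (s * M)..} = (\<Union>j\<in>{0..<int s}. point s t j ` ?I M j)" for M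
  proof (intro equalityI subsetI)
    fix m assume m: "m \<in> beads s t x \<inter> {- int (s * M)..}"
    obtain j k where jk: "m = point s t j k" "j \<in> {0..<int s}" using rep by blast
    then have "k \<in> ?I M j"
      using m ge_iff[of M j k] point_mem_beads[OF assms, of j k] by simp
    then show "m \<in> (\<Union>j\<in>{0..<int s}. point s t j ` ?I M j)" using jk by blast
  next
    fix m assume "m \<in> (\<Union>j\<in>{0..<int s}. point s t j ` ?I M j)"
    then obtain j k where "m = point s t j k" "k \<in> ?I M j" by blast
    then show "m \<in> beads s t x \<inter> {- int (s * M)..}"
      using ge_iff[of M j k] by (auto simp: beads_def)
  qed
  have disj: "point s t i ` A \<inter> point s t j ` C = {}"
    if "i \<in> {0..<int s}" "j \<in> {0..<int s}" "i \<noteq> j" for i j A C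
  proof -
    have "point s t i k \<noteq> point s t j l" for k l
    proof
      assume "point s t i k = point s t j l"
      then obtain n where "j = i + n * int s" using point_eq_iff[OF assms(1,2)] by blast
      then have "j mod int s = i mod int s" by simp
      then show False using that by simp
    qed
    then show ?thesis by blast
  qed
  have "int (card (beads s t x \<inter> {- int (s * M)..})) = int (s * M) + (\<Sum>j\<in>{0..<int s}. x j)"
    if "M \<ge> M0" for M
  proof -
    have "inj_on (point s t j) A" for j A
      using assms(2) by (auto simp: inj_on_def point_def)
    then have "card (beads s t x \<inter> {- int (s * M)..}) = (\<Sum>j\<in>{0..<int s}. card (?I M j))"
      unfolding eq using disj by (subst card_UN_disjoint) (auto simp: card_image)
    then have "int (card (beads s t x \<inter> {- int (s * M)..})) = (\<Sum>j\<in>{0..<int s}. x j + int M + q j)"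
      using bound[OF that] by (auto intro!: sum.cong)
    also have "\<dots> = int (s * M) + (\<Sum>j\<in>{0..<int s}. x j)"
      using sum_point_div[OF assms(1,2)] by (simp add: sum.distrib q_def)
    finally show ?thesis .
  qed
  moreover have "finite (beads s t x \<inter> {- int (s * M)..})" for M
    unfolding eq by auto
  ultimately show thesis using low that by blast
qed

lemma partition_of_beads:
  assumes "coprime s t" "s > 0" "x \<in> core_labels s t"
  obtains lam where "is_partition lam" "beta_set lam = beads s t x"
proof -
  have x: "quasi_periodic s (- int t) x" "(\<Sum>j\<in>{0..<int s}. x j) = 0"
    using assms(3) by (auto simp: core_labels_def)
  obtain M0 where "charge_zero (beads s t x) (s * M0)"
    using beads_charge[OF assms(1,2) x(1)] x(2) unfolding charge_zero_def
    by (metis add.right_neutral le_refl of_nat_eq_iff)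
  then show thesis using beta_set_surj that by blast
qed

lemma sum_label_of_partition:
  assumes "coprime s t" "s > 0" "quasi_periodic s (- int t) x"
    and "is_partition lam" "beta_set lam = beads s t x"
  shows "(\<Sum>j\<in>{0..<int s}. x j) = 0"
proof -
  obtain N0 where N0: "\<And>N. N \<ge> N0 \<Longrightarrow> charge_zero (beads s t x) N"
    using charge_zero_beta_set[OF assms(4)] assms(5) by metis
  obtain M0 where M0: "\<And>M. M \<ge> M0 \<Longrightarrow>
      int (card (beads s t x \<inter> {- int (s * M)..})) = int (s * M) + (\<Sum>j\<in>{0..<int s}. x j)"
    using beads_charge[OF assms(1-3)] by metis
  have "N0 * 1 \<le> s * max M0 N0" unfolding mult.commute[of s] using assms(2) by (intro mult_le_mono) auto
  then have "charge_zero (beads s t x) (s * max M0 N0)" using N0 by simp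
  then show ?thesis using M0[of "max M0 N0"] by (simp add: charge_zero_def)
qed

text \<open>Closure under subtracting \<open>s\<close> makes each runner a ray that is bounded above, since a beta-set is;
the label records where the rays end. Its quasi-periodicity is forced by the ambiguity of the
coordinates, and its sum by the charge.\<close>

lemma label_of_core:
  assumes "coprime s t" "s > 0" "lam \<in> cores s"
  obtains x where "x \<in> core_labels s t" "beta_set lam = beads s t x"
proof -
  let ?B = "beta_set lam"
  have lam: "is_partition lam" "\<And>b. b \<in> ?B \<Longrightarrow> b - int s \<in> ?B"
    using assms(3) cores_iff_beta_set[OF assms(2)] by auto
  obtain N where "charge_zero ?B N" using charge_zero_beta_set[OF lam(1)] by blast
  then have low: "{..< - int N} \<subseteq> ?B" and fin: "finite (?B \<inter> {- int N..})"
    by (auto simp: charge_zero_def)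
  obtain b where b: "\<And>m. m \<in> ?B \<Longrightarrow> m \<le> b"
  proof -
    obtain b where b: "\<And>m. m \<in> ?B \<inter> {- int N..} \<Longrightarrow> m \<le> b"
      using bdd_above_finite[OF fin] unfolding bdd_above_def by blast
    then have "m \<le> max b (- int N)" if "m \<in> ?B" for m
      using that b[of m] by (cases "m \<ge> - int N") (simp_all add: le_max_iff_disj)
    then show thesis by (rule that)
  qed
  have down: "point s t j i \<in> ?B" if "point s t j k \<in> ?B" "i \<le> k" for i j k
    using that(2)
  proof (induction i rule: int_le_induct)
    case (step i)
    have "point s t j (i - 1) = point s t j i - int s" by (simp add: point_def algebra_simps)
    then show ?case using lam(2) step by simp
  qed (rule that(1))
  have "\<exists>y. \<forall>k. point s t j k \<in> ?B \<longleftrightarrow> k < y" for j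
  proof -
    \<comment> \<open>A position so large that \<open>point j K\<close> is above all beads and \<open>point j (- K)\<close> is deep in the
      completely filled part.\<close>
    define K where "K = \<bar>j * int t - circ s t\<bar> + \<bar>b\<bar> + int N + 1"
    have K: "K \<le> int s * K"
      using mult_right_mono[of 1 "int s" K] assms(2) by (simp add: K_def)
    have K': "K > \<bar>j * int t - circ s t\<bar> + \<bar>b\<bar> + int N" by (simp add: K_def)
    define a where "a = - K"
    have "point s t j a \<in> {..< - int N}" using K K' by (simp add: point_def a_def)
    then have a: "point s t j a \<in> ?B" using low by blast
    have "point s t j K > b" using K K' by (simp add: point_def)
    then have "point s t j K \<notin> ?B" using b[of "point s t j K"] by linarith
    moreover have "a + int (nat (K - a)) = K" by (simp add: a_def K_def)
    ultimately have "point s t j (a + int (nat (K - a))) \<notin> ?B" by simp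
    then have ex: "\<exists>n. point s t j (a + int n) \<notin> ?B" by blast
    define n where "n = (LEAST n. point s t j (a + int n) \<notin> ?B)"
    have n: "point s t j (a + int n) \<notin> ?B"
      unfolding n_def using ex by (rule LeastI_ex)
    have "point s t j k \<in> ?B \<longleftrightarrow> k < a + int n" for k
    proof
      assume "point s t j k \<in> ?B"
      then show "k < a + int n" using n down[of j k "a + int n"] by (cases "k < a + int n") auto
    next
      assume k: "k < a + int n"
      show "point s t j k \<in> ?B"
      proof (cases "k \<le> a")
        case False
        then have "nat (k - a) < (LEAST n. point s t j (a + int n) \<notin> ?B)"
          using k unfolding n_def by linarith
        from not_less_Least[OF this] show ?thesis using False by simp
      qed (use a down in blast)
    qed
    then show ?thesis by blast
  qed
  then obtain x where x: "\<And>j k. point s t j k \<in> ?B \<longleftrightarrow> k < x j" by metis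
  have qp: "quasi_periodic s (- int t) x"
    unfolding quasi_periodic_def
  proof
    fix j
    have "k < x (j + int s) \<longleftrightarrow> k + int t < x j" for k
    proof -
      have "point s t (j + int s) k = point s t j (k + int t)"
        by (simp add: point_def algebra_simps)
      then show ?thesis using x by metis
    qed
    from this[of "x (j + int s)"] this[of "x j - int t"] show "x (j + int s) = x j + - int t"
      by auto
  qed
  have B: "?B = beads s t x"
  proof (rule Set.set_eqI)
    fix m
    obtain j k where "m = point s t j k" using point_exhaust[OF assms(1)] .
    then show "m \<in> ?B \<longleftrightarrow> m \<in> beads s t x"
      using x point_mem_beads[OF assms(1,2) qp] by simp
  qed
  have "x \<in> core_labels s t"
    using qp sum_label_of_partition[OF assms(1,2) qp lam(1) B] by (simp add: core_labels_def)
  then show thesis using B that by blast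
qed

definition core_of :: "nat \<Rightarrow> nat \<Rightarrow> (int \<Rightarrow> int) \<Rightarrow> nat \<Rightarrow> nat" where
  "core_of s t x = (THE lam. is_partition lam \<and> beta_set lam = beads s t x)"

lemma core_of:
  assumes "coprime s t" "s > 0" "x \<in> core_labels s t"
  shows "is_partition (core_of s t x)" "beta_set (core_of s t x) = beads s t x"
proof -
  have "\<exists>!lam. is_partition lam \<and> beta_set lam = beads s t x"
    using partition_of_beads[OF assms] beta_set_inject by metis
  from theI'[OF this] show "is_partition (core_of s t x)" "beta_set (core_of s t x) = beads s t x"
    by (simp_all add: core_of_def)
qed

lemma core_of_mem_cores:
  assumes "coprime s t" "s > 0" "x \<in> core_labels s t"
  shows "core_of s t x \<in> cores s"
  using core_of[OF assms] cores_iff_beta_set[OF assms(2)] beads_minus_s by auto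

lemma bij_betw_core_of:
  assumes "coprime s t" "s > 0" "t > 0"
  shows "bij_betw (core_of s t) (dominant_labels s t) (cores s \<inter> cores t)"
proof (rule bij_betw_imageI)
  show "inj_on (core_of s t) (dominant_labels s t)"
  proof (rule inj_onI)
    fix x y assume "x \<in> dominant_labels s t" "y \<in> dominant_labels s t"
      and eq: "core_of s t x = core_of s t y"
    then have xy: "x \<in> core_labels s t" "y \<in> core_labels s t" by (auto simp: dominant_labels_def)
    then have "beads s t x = beads s t y"
      using core_of(2)[OF assms(1,2)] eq by metis
    then show "x = y"
      using xy by (intro beads_inject[OF assms(1,2)]) (auto simp: core_labels_def)
  qed
  have t_core: "core_of s t x \<in> cores t \<longleftrightarrow> x \<in> dominant_labels s t"
    if x: "x \<in> core_labels s t" for x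
    using cores_iff_beta_set[OF assms(3)] core_of[OF assms(1,2) x] x
      beads_minus_t_iff[OF assms(1,2), of x]
    by (simp add: dominant_labels_def core_labels_def)
  show "core_of s t ` dominant_labels s t = cores s \<inter> cores t"
  proof (intro equalityI subsetI)
    fix lam assume lam: "lam \<in> cores s \<inter> cores t"
    then obtain x where x: "x \<in> core_labels s t" "beta_set lam = beads s t x"
      using label_of_core[OF assms(1,2)] by blast
    have "core_of s t x = lam"
      using lam core_of[OF assms(1,2) x(1)] x(2) by (intro beta_set_inject) (auto simp: cores_def)
    then show "lam \<in> core_of s t ` dominant_labels s t"
      using lam t_core[OF x(1)] by blast
  qed (use t_core core_of_mem_cores[OF assms(1,2)] in \<open>auto simp: dominant_labels_def\<close>)
qed

lemma core_labels_comp: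
  assumes "s > 0" "x \<in> core_labels s t" "w \<in> carrier (affine_sym s)"
  shows "x \<circ> w \<in> core_labels s t"
proof -
  have x: "quasi_periodic s (- int t) x" "(\<Sum>j\<in>{0..<int s}. x j) = 0"
    and w: "inj w" "quasi_periodic s s w" "(\<Sum>m\<in>{0..<int s}. w m - m) = 0"
    using assms by (auto simp: core_labels_def affine_sym_iff bij_def)
  have "int s * (\<Sum>j\<in>{0..<int s}. x (w j)) = 0"
    using sum_quasi_periodic_compose[OF _ w(2,1) x(1)] assms(1) w(3) x(2) by simp
  then show ?thesis using x w assms(1) by (simp add: core_labels_def quasi_periodic_def)
qed

text \<open>The core with label \<open>x\<close> is sent to the core with label \<open>x \<circ> w\<inverse>\<close>. It matters that \<open>x \<circ> w\<inverse>\<close> is again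
a label: only then is the image of the beta-set the beta-set of a partition, so that the definite
description in the definition of the action has a meaning.\<close>

lemma Stab_core_of:
  assumes "coprime s t" "s \<ge> 2" "x \<in> core_labels s t"
  shows "Stab s t (core_of s t x) = {w \<in> carrier (affine_sym s). x \<circ> w = x}"
proof -
  have s: "s > 0" using assms(2) by simp
  have "core_action s t w (core_of s t x) = core_of s t x \<longleftrightarrow> x \<circ> w = x"
    if w: "w \<in> carrier (affine_sym s)" for w
  proof -
    let ?v = "inv_into UNIV w"
    have w': "bij w" "quasi_periodic s s w" using w by (simp_all add: affine_sym_iff)
    have y: "x \<circ> ?v \<in> core_labels s t"
      using core_labels_comp[OF s assms(3) inv_mem_affine_sym[OF s w]] .
    have action: "core_action s t w (core_of s t x) = core_of s t (x \<circ> ?v)"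
      unfolding core_action_def
      using core_of_mem_cores[OF assms(1) s assms(3)] core_of(2)[OF assms(1) s assms(3)]
        level_action_eq_level_map[OF assms(1,2) w] level_map_beads[OF assms(1) s w'(2,1)]
      by (simp add: core_of_def)
    have "core_of s t (x \<circ> ?v) = core_of s t x \<longleftrightarrow> x \<circ> ?v = x"
    proof
      assume "core_of s t (x \<circ> ?v) = core_of s t x"
      then have "beads s t (x \<circ> ?v) = beads s t x"
        using core_of(2)[OF assms(1) s y] core_of(2)[OF assms(1) s assms(3)] by simp
      then show "x \<circ> ?v = x"
        using y assms(3) by (intro beads_inject[OF assms(1) s]) (auto simp: core_labels_def)
    qed simp
    also have "x \<circ> ?v = x \<longleftrightarrow> x \<circ> w = x"
    proof -
      have "?v \<circ> w = id" "w \<circ> ?v = id"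
        using w'(1) by (auto simp: bij_def fun_eq_iff surj_f_inv_f)
      then show ?thesis by (metis comp_assoc comp_id)
    qed
    finally show ?thesis unfolding action .
  qed
  then show ?thesis by (auto simp: Stab_def stabilizer_def)
qed

section \<open>Counting lists by their underlying multisets\<close>

text \<open>Orbit counting for permutations acting on positions: the rearrangements of \<open>xs\<close> form one orbit, and
the permutations that produce a given rearrangement form a coset of those that fix \<open>xs\<close>.\<close>

lemma card_rearrangements_mult_card_fixing:
  fixes xs :: "'a list"
  assumes "length xs = n"
  shows "card {ys. mset ys = mset xs} * card {p. p permutes {..<n} \<and> permute_list p xs = xs} = fact n"
proof -
  let ?S = "{p. p permutes {..<n}}"
  let ?F = "\<lambda>ys. {p \<in> ?S. permute_list p xs = ys}"
  have img: "(\<lambda>p. permute_list p xs) ` ?S = {ys. mset ys = mset xs}"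
  proof (intro equalityI subsetI)
    fix ys assume "ys \<in> {ys. mset ys = mset xs}"
    then obtain p where "p permutes {..<length xs}" "permute_list p xs = ys"
      using mset_eq_permutation[of ys xs] by auto
    then show "ys \<in> (\<lambda>p. permute_list p xs) ` ?S" using assms by auto
  qed (use assms in auto)
  have fiber: "card (?F ys) = card (?F xs)" if ys: "mset ys = mset xs" for ys
  proof -
    have "ys \<in> (\<lambda>p. permute_list p xs) ` ?S" using img ys by blast
    then obtain q where q: "q permutes {..<n}" "permute_list q xs = ys" by auto
    have "bij_betw (\<lambda>p. p \<circ> q) (?F xs) (?F ys)"
    proof (rule bij_betw_byWitness[where f' = "\<lambda>p. p \<circ> inv_into UNIV q"])
      show "\<forall>p\<in>?F xs. (p \<circ> q) \<circ> inv_into UNIV q = p" "\<forall>p\<in>?F ys. (p \<circ> inv_into UNIV q) \<circ> q = p"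
        using permutes_inv_o[OF q(1)] by (simp_all add: comp_assoc)
      show "(\<lambda>p. p \<circ> q) ` ?F xs \<subseteq> ?F ys"
        using q assms by (auto simp: permutes_compose permute_list_compose)
      have "permute_list (inv_into UNIV q) ys = xs"
        using permute_list_compose[of "inv_into UNIV q" xs q] permute_list_compose[of q xs "inv_into UNIV q"]
          q permutes_inv[OF q(1)] permutes_inv_o[OF q(1)] assms by simp
      then show "(\<lambda>p. p \<circ> inv_into UNIV q) ` ?F ys \<subseteq> ?F xs"
        using permutes_inv[OF q(1)] assms
        by (auto simp: permutes_compose permute_list_compose)
    qed
    then show ?thesis by (simp add: bij_betw_same_card)
  qed
  have fin: "finite ?S" by (simp add: finite_permutations)
  have "fact n = card ?S" by (simp add: card_permutations)
  also have "\<dots> = (\<Sum>ys\<in>(\<lambda>p. permute_list p xs) ` ?S. card (?F ys))"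
    using sum.image_gen[OF fin, of "\<lambda>_. 1 :: nat" "\<lambda>p. permute_list p xs"] by simp
  also have "\<dots> = (\<Sum>ys\<in>{ys. mset ys = mset xs}. card (?F xs))"
    unfolding img by (rule sum.cong[OF refl]) (rule fiber, simp)
  finally show ?thesis by simp
qed

definition zero_sum_lists :: "nat \<Rightarrow> nat \<Rightarrow> int list set" where
  "zero_sum_lists s t = {xs. length xs = s \<and> set xs \<subseteq> {0..<int t} \<and> int t dvd sum_list xs}"

lemma finite_zero_sum_lists: "finite (zero_sum_lists s t)"
  by (rule finite_subset[OF _ finite_lists_length_eq[of "{0..<int t}" s]])
    (auto simp: zero_sum_lists_def)

text \<open>The tail of the list is arbitrary, and it determines the head.\<close>

lemma card_zero_sum_lists:
  assumes "s > 0" "t > 0"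
  shows "card (zero_sum_lists s t) = t ^ (s - 1)"
proof -
  let ?T = "{ys. set ys \<subseteq> {0..<int t} \<and> length ys = s - 1}"
  let ?f = "\<lambda>ys. (- sum_list ys) mod int t # ys"
  have "?f ` ?T = zero_sum_lists s t"
  proof (intro equalityI subsetI)
    fix xs assume "xs \<in> zero_sum_lists s t"
    then have xs: "length xs = s" "set xs \<subseteq> {0..<int t}" "int t dvd sum_list xs"
      by (auto simp: zero_sum_lists_def)
    then obtain y ys where y: "xs = y # ys" using assms(1) by (cases xs) auto
    have "y mod int t = (- sum_list ys) mod int t"
      using xs(3) y by (simp add: mod_eq_dvd_iff)
    then have "xs = ?f ys" using xs(2) y by simp
    then show "xs \<in> ?f ` ?T" using xs y by auto
  next
    fix xs assume "xs \<in> ?f ` ?T"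
    then obtain ys where ys: "xs = ?f ys" "set ys \<subseteq> {0..<int t}" "length ys = s - 1" by blast
    have "int t dvd (- sum_list ys) mod int t + sum_list ys"
      by (simp add: mod_eq_0_iff_dvd[symmetric] mod_add_left_eq)
    then show "xs \<in> zero_sum_lists s t"
      using assms ys by (simp add: zero_sum_lists_def)
  qed
  moreover have "inj_on ?f ?T" by (auto simp: inj_on_def)
  ultimately have "card (zero_sum_lists s t) = card ?T"
    using card_image[of ?f ?T] by simp
  then show ?thesis by (simp add: card_lists_length_eq)
qed

section \<open>Dominant labels and multisets of residues\<close>

definition residue_list :: "nat \<Rightarrow> nat \<Rightarrow> (int \<Rightarrow> int) \<Rightarrow> int list" where
  "residue_list s t x = map (\<lambda>i. x (int i) mod int t) [0..<s]"

lemma mset_map_upt_int: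
  "mset (map (\<lambda>i. f (int i)) [0..<s]) = image_mset f (mset_set {0..<int s})"
proof -
  have "mset_set {0..<int s} = image_mset int (mset_set {0..<s})"
    by (simp add: image_mset_mset_set image_int_atLeastLessThan)
  then show ?thesis by (simp add: multiset.map_comp comp_def)
qed

text \<open>The sum of the residues is congruent to the sum of the label over a period, which is \<open>0\<close>.\<close>

lemma residue_list_mem:
  assumes "t > 0" "x \<in> core_labels s t"
  shows "residue_list s t x \<in> zero_sum_lists s t"
proof -
  have "sum_list (residue_list s t x) = (\<Sum>j\<in>{0..<int s}. x j mod int t)"
    unfolding residue_list_def sum_mset_sum_list[symmetric]
      mset_map_upt_int[of "\<lambda>j. x j mod int t"] by (simp add: sum_unfold_sum_mset)
  then have "sum_list (residue_list s t x) mod int t = (\<Sum>j\<in>{0..<int s}. x j) mod int t"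
    by (simp add: mod_sum_eq)
  then have "int t dvd sum_list (residue_list s t x)"
    using assms(2) by (simp add: core_labels_def mod_eq_0_iff_dvd[symmetric])
  then show ?thesis using assms(1) by (auto simp: zero_sum_lists_def residue_list_def)
qed

lemma quasi_periodic_shift:
  assumes "quasi_periodic p d f"
  shows "quasi_periodic p d (\<lambda>m. f (m + k))"
  unfolding quasi_periodic_def
proof
  fix m
  have "m + p + k = (m + k) + p" by simp
  then show "f (m + p + k) = f (m + k) + d"
    using assms unfolding quasi_periodic_def by metis
qed

lemma sum_label_shift:
  assumes "s > 0" "quasi_periodic s (- int t) x"
  shows "(\<Sum>j\<in>{0..<int s}. x (j + k)) = (\<Sum>j\<in>{0..<int s}. x j) - int t * k"
proof -
  have "int s * (\<Sum>j\<in>{0..<int s}. x (j + k)) - int s * (\<Sum>j\<in>{0..<int s}. x j)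
      = - int t * (\<Sum>j\<in>{0..<int s}. j + k - j)"
    using assms by (intro sum_quasi_periodic_compose) (auto simp: quasi_periodic_def inj_def)
  then have "int s * ((\<Sum>j\<in>{0..<int s}. x (j + k)) - (\<Sum>j\<in>{0..<int s}. x j) + int t * k) = 0"
    by (simp add: algebra_simps)
  then show ?thesis using assms(1) by simp
qed

lemma mset_residue_list_shift:
  assumes "s > 0" "quasi_periodic s (- int t) x"
  shows "mset (residue_list s t (\<lambda>j. x (j + k))) = mset (residue_list s t x)"
  unfolding residue_list_def mset_map_upt_int[of "\<lambda>j. x j mod int t"]
    mset_map_upt_int[of "\<lambda>j. x (j + k) mod int t"]
proof (rule image_mset_periodic_compose)
  show "x (m + int s) mod int t = x m mod int t" for m
    using assms(2) by (simp add: quasi_periodic_def)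
qed (use assms(1) in \<open>auto simp: quasi_periodic_def inj_def\<close>)

lemma decreasing_int_le:
  fixes x :: "int \<Rightarrow> int"
  assumes "\<And>j. x (j + 1) \<le> x j" "i \<le> j"
  shows "x j \<le> x i"
  using assms(2)
proof (induction j rule: int_ge_induct)
  case (step j)
  then show ?case using assms(1)[of j] by simp
qed simp

text \<open>Up to a shift of its argument, a dominant label is the decreasingly sorted list of its
residues. Indeed, let \<open>k\<close> be the first place where it falls below \<open>t\<close>. The value at \<open>k - 1\<close> is still
at least \<open>t\<close>, so the value one period later, at \<open>k + s - 1\<close>, is still nonnegative; hence the values at
\<open>k, \<dots>, k + s - 1\<close> lie between \<open>0\<close> and \<open>t - 1\<close> and are their own residues.\<close>

lemma dominant_label_window:
  assumes "s > 0" "t > 0" "x \<in> dominant_labels s t"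
  obtains k where "map (\<lambda>i. x (int i + k)) [0..<s] = rev (sort (residue_list s t x))"
proof -
  have qp: "quasi_periodic s (- int t) x" and dec: "\<And>j. x (j + 1) \<le> x j"
    using assms(3) by (auto simp: dominant_labels_def core_labels_def)
  \<comment> \<open>Going back \<open>\<bar>x 0\<bar> + 1\<close> periods raises the label to at least \<open>t\<close>, from where the search for
    the first value below \<open>t\<close> can start.\<close>
  define a where "a = - (\<bar>x 0\<bar> + 1) * int s"
  have xa: "x a \<ge> int t"
  proof -
    have "x a = x 0 + (\<bar>x 0\<bar> + 1) * int t"
      using quasi_periodic_mult[OF qp, of 0 "- (\<bar>x 0\<bar> + 1)"] by (simp add: a_def algebra_simps)
    moreover have "\<bar>x 0\<bar> * 1 \<le> \<bar>x 0\<bar> * int t" using assms(2) by (intro mult_left_mono) auto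
    ultimately show ?thesis by (simp add: algebra_simps)
  qed
  have "\<exists>n. x (a + int n) < int t"
  proof
    have "x (a + int (nat (x a)) * int s) = x a - x a * int t"
      using quasi_periodic_mult[OF qp, of a "x a"] xa by simp
    moreover have "x a * 1 \<le> x a * int t" using assms(2) xa by (intro mult_left_mono) auto
    ultimately show "x (a + int (nat (x a) * s)) < int t" using assms(2) by simp
  qed
  then have ex: "x (a + int (LEAST n. x (a + int n) < int t)) < int t" by (rule LeastI_ex)
  define n where "n = (LEAST n. x (a + int n) < int t)"
  have n: "x (a + int n) < int t" using ex by (simp add: n_def)
  then have "n > 0" using xa by (cases n) auto
  then have "n - 1 < (LEAST n. x (a + int n) < int t)" unfolding n_def by linarith
  then have "\<not> x (a + int (n - 1)) < int t" by (rule not_less_Least)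
  define k where "k = a + int n"
  have k: "x k < int t" "x (k - 1) \<ge> int t"
    using n \<open>\<not> x (a + int (n - 1)) < int t\<close> \<open>n > 0\<close> by (simp_all add: k_def of_nat_diff algebra_simps)
  have range: "0 \<le> x (int i + k) \<and> x (int i + k) < int t" if "i < s" for i
  proof
    have "x (k - 1 + int s) = x (k - 1) - int t" using qp by (simp add: quasi_periodic_def)
    moreover have "x (k - 1 + int s) \<le> x (int i + k)"
      using that by (intro decreasing_int_le[of x, OF dec]) auto
    ultimately show "0 \<le> x (int i + k)" using k(2) by simp
    show "x (int i + k) < int t"
      using decreasing_int_le[of x k "int i + k", OF dec] k(1) by simp
  qed
  let ?W = "map (\<lambda>i. x (int i + k)) [0..<s]"
  have "?W = residue_list s t (\<lambda>j. x (j + k))"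
    unfolding residue_list_def using range by simp
  then have "mset ?W = mset (residue_list s t x)"
    using mset_residue_list_shift[OF assms(1) qp] by simp
  moreover have "sorted (rev ?W)"
    unfolding sorted_wrt_rev by (simp add: sorted_wrt_iff_nth_less) (auto intro: decreasing_int_le[of x, OF dec])
  ultimately have "sort (residue_list s t x) = rev ?W"
    by (intro properties_for_sort) simp_all
  then have "?W = rev (sort (residue_list s t x))" by simp
  then show thesis by (rule that)
qed

text \<open>Two dominant labels with the same residues coincide up to a shift of the argument; a shift by
\<open>d\<close> changes the sum over a period by \<open>- t d\<close>, so it must be trivial.\<close>

lemma dominant_label_unique:
  assumes "s > 0" "t > 0" "x \<in> dominant_labels s t" "y \<in> dominant_labels s t"
    and "mset (residue_list s t x) = mset (residue_list s t y)"
  shows "x = y"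
proof -
  have x: "quasi_periodic s (- int t) x" "(\<Sum>j\<in>{0..<int s}. x j) = 0"
    and y: "quasi_periodic s (- int t) y" "(\<Sum>j\<in>{0..<int s}. y j) = 0"
    using assms(3,4) by (auto simp: dominant_labels_def core_labels_def)
  obtain k where k: "map (\<lambda>i. x (int i + k)) [0..<s] = rev (sort (residue_list s t x))"
    using dominant_label_window[OF assms(1-3)] .
  obtain l where l: "map (\<lambda>i. y (int i + l)) [0..<s] = rev (sort (residue_list s t y))"
    using dominant_label_window[OF assms(1,2,4)] .
  have "sort (residue_list s t x) = sort (residue_list s t y)"
    using assms(5) by (intro properties_for_sort) simp_all
  then have "map (\<lambda>i. x (int i + k)) [0..<s] = map (\<lambda>i. y (int i + l)) [0..<s]"
    using k l by simp
  then have eq: "x (int i + k) = y (int i + l)" if "i < s" for i using that by simp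
  have "(\<lambda>j. x (j + k)) = (\<lambda>j. y (j + l))"
  proof (rule quasi_periodic_eqI)
    show "quasi_periodic s (- int t) (\<lambda>j. x (j + k))" "quasi_periodic s (- int t) (\<lambda>j. y (j + l))"
      using x(1) y(1) by (auto intro: quasi_periodic_shift)
    fix j :: int assume "0 \<le> j" "j < int s"
    then show "x (j + k) = y (j + l)" using eq[of "nat j"] by simp
  qed (use assms(1) in simp)
  then have shift: "x j = y (j + (l - k))" for j
    by (drule_tac x = "j - k" in fun_cong) (simp add: algebra_simps)
  have "(\<Sum>j\<in>{0..<int s}. y (j + (l - k))) = - int t * (l - k)"
    using sum_label_shift[OF assms(1) y(1)] y(2) by simp
  then have "l = k" using x(2) assms(2) by (simp add: shift)
  then show ?thesis using shift by auto
qed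

text \<open>Sort the residues decreasingly and extend quasi-periodically; the extension is decreasing at the seam
because all entries are at least \<open>0\<close> and less than \<open>t\<close>. If the residues sum to \<open>t m\<close>, shifting the
argument by \<open>m\<close> makes the sum over a period zero.\<close>

lemma dominant_label_exists:
  assumes "s > 0" "t > 0" "xs \<in> zero_sum_lists s t"
  obtains x where "x \<in> dominant_labels s t" "mset (residue_list s t x) = mset xs"
proof -
  have xs: "length xs = s" "set xs \<subseteq> {0..<int t}" "int t dvd sum_list xs"
    using assms(3) by (auto simp: zero_sum_lists_def)
  define ys where "ys = rev (sort xs)"
  have len: "length ys = s" and ms: "mset ys = mset xs" and "set ys \<subseteq> {0..<int t}"
    using xs by (auto simp: ys_def)
  have range: "0 \<le> ys ! i" "ys ! i < int t" if "i < length ys" for i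
  proof -
    have "ys ! i \<in> {0..<int t}" using that \<open>set ys \<subseteq> _\<close> by (meson nth_mem subsetD)
    then show "0 \<le> ys ! i" "ys ! i < int t" by simp_all
  qed
  have "sorted_wrt (\<ge>) ys" unfolding ys_def sorted_wrt_rev by simp
  then have dec: "ys ! j \<le> ys ! i" if "i < j" "j < s" for i j
    using that len by (simp add: sorted_wrt_iff_nth_less)
  define z where "z j = ys ! nat (j mod int s) - j div int s * int t" for j
  have qz: "quasi_periodic s (- int t) z"
    using assms(1) by (simp add: quasi_periodic_def z_def algebra_simps)
  have z: "z (int i) = ys ! i" if "i < s" for i
    using that by (simp add: z_def)
  have step: "z (j + 1) \<le> z j" for j
  proof -
    define i where "i = nat (j mod int s)"
    have i: "j mod int s = int i" "i < s" using assms(1) by (auto simp: i_def nat_less_iff)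
    then have j: "j = int i + j div int s * int s" by (metis add.commute div_mult_mod_eq)
    have "z (int i + 1) \<le> z (int i)"
    proof (cases "Suc i < s")
      case True
      then show ?thesis using z[of "Suc i"] z[of i] dec[of i "Suc i"] by (simp add: add.commute)
    next
      case False
      then have "int i + 1 = 0 + int s" using i by simp
      then have "z (int i + 1) = z (int 0) - int t"
        using quasi_periodic_mult[OF qz, of 0 1] by simp
      then show ?thesis using z[of i] z[of 0] i range[of 0] range[of i] assms(1) len i(2) by simp
    qed
    moreover have "z (j + 1) = z (int i + 1) + j div int s * - int t"
      using quasi_periodic_mult[OF qz, of "int i + 1" "j div int s"] j by (simp add: algebra_simps)
    moreover have "z j = z (int i) + j div int s * - int t"
      using quasi_periodic_mult[OF qz, of "int i" "j div int s"] j by simp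
    ultimately show ?thesis by simp
  qed
  have map_z: "map (\<lambda>i. z (int i)) [0..<s] = ys"
    using z len by (intro nth_equalityI) auto
  obtain m where m: "sum_list xs = int t * m" using xs(3) ..
  have "(\<Sum>j\<in>{0..<int s}. z j) = sum_list ys"
    unfolding map_z[symmetric] sum_mset_sum_list[symmetric] mset_map_upt_int
    by (simp add: sum_unfold_sum_mset)
  also have "\<dots> = int t * m" using ms m by (metis sum_mset_sum_list)
  finally have sum: "(\<Sum>j\<in>{0..<int s}. z (j + m)) = 0"
    using sum_label_shift[OF assms(1) qz, of m] by simp
  have "residue_list s t z = ys"
    unfolding residue_list_def using z len range by (intro nth_equalityI) auto
  then have res: "mset (residue_list s t (\<lambda>j. z (j + m))) = mset xs"
    using mset_residue_list_shift[OF assms(1) qz] ms by simp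
  have "quasi_periodic s (- int t) (\<lambda>j. z (j + m))"
    using qz by (rule quasi_periodic_shift)
  moreover have "z (j + 1 + m) \<le> z (j + m)" for j
    using step[of "j + m"] by (simp add: algebra_simps)
  ultimately have "(\<lambda>j. z (j + m)) \<in> dominant_labels s t"
    using sum by (simp add: dominant_labels_def core_labels_def)
  then show thesis using res that by blast
qed

lemma bij_betw_dominant_labels_multisets:
  assumes "s > 0" "t > 0"
  shows "bij_betw (\<lambda>x. mset (residue_list s t x)) (dominant_labels s t) (mset ` zero_sum_lists s t)"
proof (rule bij_betw_imageI)
  show "inj_on (\<lambda>x. mset (residue_list s t x)) (dominant_labels s t)"
    using dominant_label_unique[OF assms] by (auto simp: inj_on_def)
  show "(\<lambda>x. mset (residue_list s t x)) ` dominant_labels s t = mset ` zero_sum_lists s t"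
  proof (intro equalityI subsetI)
    fix M assume "M \<in> mset ` zero_sum_lists s t"
    then obtain xs where "xs \<in> zero_sum_lists s t" "M = mset xs" by blast
    then show "M \<in> (\<lambda>x. mset (residue_list s t x)) ` dominant_labels s t"
      using dominant_label_exists[OF assms] by (metis imageI)
  qed (use residue_list_mem[OF assms(2)] in \<open>auto simp: dominant_labels_def\<close>)
qed

section \<open>Stabilisers as permutations\<close>

definition residue_perm :: "nat \<Rightarrow> (int \<Rightarrow> int) \<Rightarrow> nat \<Rightarrow> nat" where
  "residue_perm s w i = (if i < s then nat (w (int i) mod int s) else i)"

lemma residue_perm_permutes:
  assumes "s > 0" "quasi_periodic s s w" "inj w"
  shows "residue_perm s w permutes {..<s}"
proof (rule bij_imp_permutes)
  have "inj_on (\<lambda>j. w j mod int s) {0..<int s}"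
    using bij_betw_residues[OF _ assms(2,3)] assms(1) by (simp add: bij_betw_def)
  then have inj: "int i = int j"
    if "i < s" "j < s" "w (int i) mod int s = w (int j) mod int s" for i j
    using that by (rule_tac inj_onD[of "\<lambda>j. w j mod int s" "{0..<int s}"]) simp_all
  have "inj_on (residue_perm s w) {..<s}"
  proof (rule inj_onI)
    fix i j assume "i \<in> {..<s}" "j \<in> {..<s}" "residue_perm s w i = residue_perm s w j"
    then have "i < s" "j < s" "w (int i) mod int s = w (int j) mod int s"
      using assms(1) by (simp_all add: residue_perm_def eq_nat_nat_iff)
    then have "int i = int j" by (rule inj)
    then show "i = j" by simp
  qed
  moreover have "residue_perm s w ` {..<s} \<subseteq> {..<s}"
  proof (rule image_subsetI)
    fix i assume "i \<in> {..<s}"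
    moreover have "w (int i) mod int s < int s" using assms(1) by simp
    ultimately show "residue_perm s w i \<in> {..<s}" by (simp add: residue_perm_def nat_less_iff)
  qed
  ultimately show "bij_betw (residue_perm s w) {..<s} {..<s}"
    by (simp add: bij_betw_def endo_inj_surj)
qed (simp add: residue_perm_def)

lemma permute_residue_list_eq_iff:
  assumes "p permutes {..<s}"
  shows "permute_list p (residue_list s t x) = residue_list s t x \<longleftrightarrow>
    (\<forall>i<s. x (int (p i)) mod int t = x (int i) mod int t)"
proof -
  have "p i < s" if "i < s" for i using permutes_in_image[OF assms] that by simp
  then show ?thesis
    using assms by (auto simp: list_eq_iff_nth_eq residue_list_def permute_list_nth)
qed

lemma label_mod_cong:
  assumes "quasi_periodic s (- int t) x"
  shows "x (j mod int s) mod int t = x j mod int t"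
proof -
  have "x j = x (j mod int s) + - (j div int s) * int t"
    using quasi_periodic_mod[OF assms, of j] by simp
  then show ?thesis by (simp only: mod_mult_self1)
qed

text \<open>If \<open>x \<circ> w = x\<close>, then \<open>w\<close> is recovered from its reduction modulo \<open>s\<close>: among the integers in
one residue class the label takes each value at most once. Conversely a permutation that preserves
the residues of \<open>x\<close> modulo \<open>t\<close> lifts, by choosing in the class of the image of \<open>j\<close> the integer
with label \<open>x j\<close>. The normalisation of the lift comes for free from \<open>x \<circ> w = x\<close>.\<close>

lemma bij_betw_residue_perm:
  assumes "s > 0" "t > 0" "x \<in> core_labels s t"
  shows "bij_betw (residue_perm s) {w \<in> carrier (affine_sym s). x \<circ> w = x}
    {p. p permutes {..<s} \<and> permute_list p (residue_list s t x) = residue_list s t x}"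
proof (rule bij_betw_imageI)
  have x: "quasi_periodic s (- int t) x"
    using assms(3) by (simp add: core_labels_def)
  let ?W = "{w \<in> carrier (affine_sym s). x \<circ> w = x}"
  let ?P = "{p. p permutes {..<s} \<and> permute_list p (residue_list s t x) = residue_list s t x}"
  have W: "quasi_periodic s s w" "inj w" "x (w j) = x j" if "w \<in> ?W" for w j
    using that by (auto simp: affine_sym_iff bij_def fun_eq_iff)
  have same: "i = j" if "i mod int s = j mod int s" "x i = x j" for i j
  proof -
    have "i div int s * - int t = j div int s * - int t"
      using quasi_periodic_mod[OF x, of i] quasi_periodic_mod[OF x, of j] that by auto
    then have "i div int s = j div int s" using assms(2) by auto
    then show ?thesis using that(1) by (metis div_mult_mod_eq)
  qed
  show "inj_on (residue_perm s) ?W"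
  proof (rule inj_onI)
    fix v w assume vw: "v \<in> ?W" "w \<in> ?W" and eq: "residue_perm s v = residue_perm s w"
    show "v = w"
    proof (rule quasi_periodic_eqI[OF _ W(1)[OF vw(1)] W(1)[OF vw(2)]])
      fix j :: int assume j: "0 \<le> j" "j < int s"
      then have "v j mod int s = w j mod int s"
        using fun_cong[OF eq, of "nat j"] assms(1)
        by (simp add: residue_perm_def eq_nat_nat_iff nat_less_iff)
      moreover have "x (v j) = x (w j)" using W(3)[OF vw(1)] W(3)[OF vw(2)] by simp
      ultimately show "v j = w j" by (rule same)
    qed (use assms(1) in simp)
  qed
  show "residue_perm s ` ?W = ?P"
  proof (intro equalityI subsetI)
    fix p assume "p \<in> residue_perm s ` ?W"
    then obtain w where w: "w \<in> ?W" and p: "p = residue_perm s w" by blast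
    have perm: "p permutes {..<s}"
      unfolding p using residue_perm_permutes[OF assms(1) W(1,2)[OF w]] .
    have "x (int (p i)) mod int t = x (int i) mod int t" if "i < s" for i
      using that assms(1) label_mod_cong[OF x, of "w (int i)"] W(3)[OF w, of "int i"]
      by (simp add: p residue_perm_def)
    then show "p \<in> ?P" using perm permute_residue_list_eq_iff[OF perm] by simp
  next
    fix p assume "p \<in> ?P"
    then have perm: "p permutes {..<s}" and fixed: "permute_list p (residue_list s t x) = residue_list s t x"
      by simp_all
    have px: "x (int (p i)) mod int t = x (int i) mod int t" if "i < s" for i
      using permute_residue_list_eq_iff[OF perm, of t x] fixed that by blast
    define q where "q j = int (p (nat (j mod int s)))" for j
    \<comment> \<open>Moving by one period lowers the label by \<open>t\<close>; the quotient is the number of periods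
      after which the label at \<open>q j\<close> has become \<open>x j\<close>.\<close>
    define w where "w j = q j + int s * ((x (q j) - x j) div int t)" for j
    have idx: "nat (j mod int s) < s" for j using assms(1) by (simp add: nat_less_iff)
    have q: "0 \<le> q j" "q j < int s" for j
      using permutes_in_image[OF perm, of "nat (j mod int s)"] idx[of j] by (auto simp: q_def)
    have "x (q j) mod int t = x j mod int t" for j
      using px[OF idx[of j]] label_mod_cong[OF x, of j] assms(1) by (simp add: q_def)
    then have dvd: "int t dvd x (q j) - x j" for j by (simp add: mod_eq_dvd_iff)
    have w_mod: "w j mod int s = q j" for j using q[of j] by (simp add: w_def)
    have xw: "x (w j) = x j" for j
    proof -
      have "x (w j) = x (q j) - (x (q j) - x j) div int t * int t"
        unfolding w_def using quasi_periodic_mult[OF x, of "q j" "(x (q j) - x j) div int t"]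
        by (simp add: mult.commute)
      then show ?thesis using dvd[of j] by simp
    qed
    have qp: "quasi_periodic s s w"
      unfolding quasi_periodic_def
    proof
      fix j
      have "x (q j) - (x j + - int t) = x (q j) - x j + int t" by simp
      then have "(x (q j) - (x j + - int t)) div int t = (x (q j) - x j) div int t + 1"
        using assms(2) by (simp only: div_add_self2)
      moreover have "q (j + int s) = q j" by (simp add: q_def)
      moreover have "x (j + int s) = x j + - int t" using x by (simp add: quasi_periodic_def)
      ultimately show "w (j + int s) = w j + int s"
        by (simp only: w_def distrib_left mult_1_right add.assoc)
    qed
    have inj: "inj w"
    proof (rule injI)
      fix i j assume eq: "w i = w j"
      then have "q i = q j" using w_mod[of i] w_mod[of j] by simp
      then have "nat (i mod int s) = nat (j mod int s)"
        using permutes_inj[OF perm] by (simp add: q_def inj_eq)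
      then have "i mod int s = j mod int s" using assms(1) by (simp add: eq_nat_nat_iff)
      moreover have "x i = x j" using xw[of i] xw[of j] eq by simp
      ultimately show "i = j" by (rule same)
    qed
    have "int t * (\<Sum>j\<in>{0..<int s}. w j - j) = 0"
      using sum_quasi_periodic_compose[OF _ qp inj x] assms(1) xw by simp
    then have "w \<in> ?W"
      using bij_if_inj_quasi_periodic[OF _ qp inj] qp assms(1,2) xw
      by (simp add: affine_sym_iff fun_eq_iff)
    moreover have "residue_perm s w = p"
    proof
      fix i
      show "residue_perm s w i = p i"
        using w_mod[of "int i"] permutes_not_in[OF perm, of i]
        by (simp add: residue_perm_def q_def)
    qed
    ultimately show "p \<in> residue_perm s ` ?W" by blast
  qed
qed

lemma inverse_card_Stab:
  assumes "coprime s t" "s \<ge> 2" "t > 0" "x \<in> core_labels s t"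
  shows "1 / real (card (Stab s t (core_of s t x)))
    = real (card {ys. mset ys = mset (residue_list s t x)}) / fact s"
proof -
  let ?P = "{p. p permutes {..<s} \<and> permute_list p (residue_list s t x) = residue_list s t x}"
  have "card (Stab s t (core_of s t x)) = card ?P"
    unfolding Stab_core_of[OF assms(1,2,4)] using assms
    by (intro bij_betw_same_card[OF bij_betw_residue_perm]) auto
  moreover have "card {ys. mset ys = mset (residue_list s t x)} * card ?P = fact s"
    by (rule card_rearrangements_mult_card_fixing) (simp add: residue_list_def)
  moreover have "1 / real d = real c / fact s" if "c * d = fact s" for c d :: nat
  proof -
    have "real c * real d = fact s" using that by (metis of_nat_fact of_nat_mult)
    then have "d \<noteq> 0" by (intro notI) simp
    then show ?thesis using \<open>real c * real d = fact s\<close> by (simp add: field_simps)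
  qed
  ultimately show ?thesis by metis
qed

theorem proposition3p21:
  fixes s t :: nat
  assumes "s \<ge> 2" and "t \<ge> 1" and "coprime s t"
  shows "(\<Sum>lam\<in>cores s \<inter> cores t. 1 / real (card (Stab s t lam)))
           = real t ^ (s - 1) / fact s"
proof -
  have st: "s > 0" "t > 0" using assms by auto
  let ?L = "zero_sum_lists s t"
  have "(\<Sum>lam\<in>cores s \<inter> cores t. 1 / real (card (Stab s t lam)))
      = (\<Sum>x\<in>dominant_labels s t. 1 / real (card (Stab s t (core_of s t x))))"
    by (rule sum.reindex_bij_betw[OF bij_betw_core_of[OF assms(3) st], symmetric])
  also have "\<dots> = (\<Sum>x\<in>dominant_labels s t.
      real (card {ys. mset ys = mset (residue_list s t x)}) / fact s)"
    using inverse_card_Stab[OF assms(3,1) st(2)] by (intro sum.cong) (auto simp: dominant_labels_def)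
  also have "\<dots> = (\<Sum>M\<in>mset ` ?L. real (card {ys. mset ys = M}) / fact s)"
    using sum.reindex_bij_betw[OF bij_betw_dominant_labels_multisets[OF st],
      of "\<lambda>M. real (card {ys. mset ys = M}) / fact s"] .
  also have "\<dots> = (\<Sum>M\<in>mset ` ?L. real (card {ys \<in> ?L. mset ys = M})) / fact s"
  proof -
    have "ys \<in> ?L" if "xs \<in> ?L" "mset ys = mset xs" for xs ys
    proof -
      have "sum_list ys = sum_list xs" using that(2) by (metis sum_mset_sum_list)
      then show ?thesis
        using that(1) mset_eq_length[OF that(2)] mset_eq_setD[OF that(2)]
        by (simp add: zero_sum_lists_def)
    qed
    then have "{ys. mset ys = M} = {ys \<in> ?L. mset ys = M}" if "M \<in> mset ` ?L" for M
      using that by auto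
    then show ?thesis by (simp add: sum_divide_distrib)
  qed
  also have "(\<Sum>M\<in>mset ` ?L. real (card {ys \<in> ?L. mset ys = M})) = real (card ?L)"
    using sum.image_gen[OF finite_zero_sum_lists, of "\<lambda>_. 1 :: real" s t mset] by simp
  also have "card ?L = t ^ (s - 1)" by (rule card_zero_sum_lists[OF st])
  finally show ?thesis by simp
qed

end
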